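(* Let $G^V_{\mathrm{par}}$ be a parent graph with edge matrix $\mathcal A$, let $C\subseteq V$ be a conditioning set and $M\subseteq V\setminus C$ a marginalising set. Let $F$ be the set of nodes outside $C$ that are ancestors of some node of $C$, $R=C\cup F$, $O=V\setminus R$, $N=V\setminus(C\cup M)$, $u=O\setminus M$, $v=F\setminus M$, $p=O\setminus u$, $q=F\setminus v$. With $\mathcal S^{FF.O}=\big[\operatorname{In}[\mathcal A_{RR}^{\mathrm T}\mathcal A_{RR}]\big]_{F,F}$ and (rows and columns appropriately ordered) $$\mathcal D=\operatorname{zer}_p\mathcal A,\qquad \operatorname{zer}_q\mathcal S^{FF.O}=\begin{pmatrix}\mathcal S_{qq|vC}&\mathcal P_{q|v.C}\\\cdot&\mathcal S^{vv.qO}\end{pmatrix},$$ the edge matrix components of the summary graph $G^{V\setminus[C,M]}_{\mathrm{sum}}$ in node set $N=(u,v)$ induced by $G^V_{\mathrm{par}}$ are $$\mathcal H_{uu}=\mathcal D_{uu},\qquad \mathcal H_{uv}=\operatorname{In}[\mathcal D_{uv}+\mathcal D_{uq}\mathcal P_{q|v.C}],\qquad \mathcal S^{vv.uM}=\mathcal S^{vv.qO},$$ $$\mathcal W_{uu}=\operatorname{In}\big[(\mathcal I_{uu}+\mathcal D_{up}\mathcal D_{up}^{\mathrm T})+\mathcal D_{uq}\mathcal S_{qq|vC}\mathcal D_{uq}^{\mathrm T}\big].$$ That is, the graph on $N$ with arrows given by $\mathcal H_{uu}$ and $\mathcal H_{uv}$, dashed lines within $u$ given by $\mathcal W_{uu}$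 and full lines within $v$ given by $\mathcal S^{vv.uM}$ is a summary graph, and it captures the independence structure implied by $G^V_{\mathrm{par}}$ for $Y_N$ given $Y_C$: for all pairwise disjoint $\alpha,\beta,c\subseteq N$ with $\alpha,\beta\neq\varnothing$, it implies $\alpha\perp\!\!\!\perp\beta\mid c$ if and only if $G^V_{\mathrm{par}}$ implies $\alpha\perp\!\!\!\perp\beta\mid c\cup C$.
   Context: Parent graph. A connected directed acyclic graph on the ordered node set $V=(1,\dots,d_V)$ with arrows $i\leftarrow k$ only for $i<k$ (edge-minimal for the distribution generated over it). Its edge matrix $\mathcal A$ is the binary unit upper-triangular matrix with, for $i<k$, $\mathcal A_{ik}=1$ if and only if $i\leftarrow k$. $k$ is an ancestor of $i$ (and $i$ a descendant of $k$) if there is a directed path of arrows from $k$ all pointing towards $i$. Indicator and partial closure. $\operatorname{In}[\cdot]$ replaces every non-zero entry of a matrix by $1$. $\mathcal I$ is an identity matrix. For a square binary matrix $\mathcal F$ with unit diagonal indexed by $a\cup b$ (disjoint), with $n-1=d_a=|a|$, $$\operatorname{zer}_a\mathcal F=\operatorname{In}\begin{pmatrix}\mathcal F_{aa}^-&\mathcal F_{aa}^-\mathcal F_{ab}\\\mathcal F_{ba}\mathcal F_{aa}^-&\mathcal F_{bb}+\mathcal F_{ba}\mathcal F_{aa}^-\mathcal F_{ab}\end{pmatrix},\qquad \mathcal F_{aa}^-=\operatorname{In}[(n\,\mathcal I_{aa}-\mathcal F_{aa})^{-1}],$$ and $\operatorname{zer}_\varnothing\mathcal F=\mathcal F$. Subscripts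 denote submatrices; $\cdot$ denotes a symmetric entry. Summary graph. A graph on $N$ with ordered partition $N=(u,v)$ (parts may be empty): within $u$ a directed acyclic graph (arrows) together with a covariance graph (dashed lines $i\,\text{- -}\,k$), a pair possibly coupled by both; within $v$ only full lines $i\,\text{---}\,k$; between $u$ and $v$ only arrows pointing from $v$ to $u$. Edge matrices (off-diagonal entries): $i\leftarrow k$ iff $(\mathcal H_{uu})_{ik}=1$ for $i\ne k$ in $u$; $i\leftarrow k$ iff $(\mathcal H_{uv})_{ik}=1$ for $i\in u,k\in v$; $i\,\text{- -}\,k$ iff $(\mathcal W_{uu})_{ik}=1$ for $i\neq k$ in $u$; $i\,\text{---}\,k$ iff $(\mathcal S^{vv.uM})_{ik}=1$ for $i\ne k$ in $v$. Implied independences. A path connects its endpoints by a sequence of edges with distinct inner nodes; a single edge is a path without inner nodes. An inner node $j$, with adjacent path edges to $i$ and $k$, is a collision node if the two edges are $i\to j\leftarrow k$, or $i\to j\,\text{- -}\,k$ (or its mirror image), or $i\,\text{- -}\,j\,\text{- -}\,k$. For pairwise disjoint node sets $\alpha,\beta,c$ with $\alpha,\beta\ne\varnothing$, a summary graph (in particular a directed acyclic graph) implies $\alpha\perp\!\!\!\perp\beta\mid c$ iff there is no path between a node of $\alpha$ and a node of $\beta$ such that every inner collision node is in $c$ or has a descendant in $c$ and every other inner node is outside $c$. *)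

theory Defs
  imports Complex_Main
begin

section \<open>Matrices indexed by node sets\<close>

text \<open>
  A matrix with rows in a node set \<open>a\<close> and columns in a node set \<open>b\<close> is a function of
  two nodes, of which only the entries in \<open>a \<times> b\<close> are meaningful. As the index sets are
  carried along explicitly, no reordering of rows and columns is needed.
\<close>

type_synonym 'a matrix = "'a \<Rightarrow> 'a \<Rightarrow> real"

definition sub :: "'a matrix \<Rightarrow> 'a set \<Rightarrow> 'a set \<Rightarrow> 'a matrix" where
  "sub X a b = (\<lambda>i k. if i \<in> a \<and> k \<in> b then X i k else 0)"

definition mident :: "'a matrix" where
  "mident = (\<lambda>i k. if i = k then 1 else 0)"

definition mtransp :: "'a matrix \<Rightarrow> 'a matrix" where
  "mtransp X = (\<lambda>i k. X k i)"

definition madd :: "'a matrix \<Rightarrow> 'a matrix \<Rightarrow> 'a matrix" where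
  "madd X Y = (\<lambda>i k. X i k + Y i k)"

text \<open>The product \<open>X Y\<close>, where \<open>a\<close> indexes the columns of \<open>X\<close> and the rows of \<open>Y\<close>.\<close>

definition mmul :: "'a set \<Rightarrow> 'a matrix \<Rightarrow> 'a matrix \<Rightarrow> 'a matrix" where
  "mmul a X Y = (\<lambda>i k. \<Sum>j\<in>a. X i j * Y j k)"

text \<open>The two-sided inverse of an \<open>a \<times> a\<close> matrix; its entries outside \<open>a \<times> a\<close> are unspecified.\<close>

definition minverse :: "'a set \<Rightarrow> 'a matrix \<Rightarrow> 'a matrix" where
  "minverse a X = (SOME Y. \<forall>i\<in>a. \<forall>k\<in>a.
     mmul a X Y i k = mident i k \<and> mmul a Y X i k = mident i k)"

definition In :: "'a matrix \<Rightarrow> 'a matrix" where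
  "In X = (\<lambda>i k. if X i k \<noteq> 0 then 1 else 0)"

definition pinverse :: "'a set \<Rightarrow> 'a matrix \<Rightarrow> 'a matrix" where
  "pinverse a X = In (minverse a (\<lambda>i k. real (card a + 1) * mident i k - X i k))"

text \<open>Partial closure over \<open>a\<close> of the matrix \<open>X\<close> indexed by \<open>a \<union> b\<close>, for disjoint \<open>a\<close> and \<open>b\<close>.\<close>

definition zer :: "'a set \<Rightarrow> 'a set \<Rightarrow> 'a matrix \<Rightarrow> 'a matrix" where
  "zer a b X = (if a = {} then X else
     (let Xaa = sub X a a; Xab = sub X a b; Xba = sub X b a; Xbb = sub X b b;
          I = pinverse a Xaa
      in In (\<lambda>i k.
           if i \<in> a \<and> k \<in> a then I i k
           else if i \<in> a \<and> k \<in> b then mmul a I Xab i k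
           else if i \<in> b \<and> k \<in> a then mmul a Xba I i k
           else if i \<in> b \<and> k \<in> b then madd Xbb (mmul a Xba (mmul a I Xab)) i k
           else 0)))"

section \<open>Mixed graphs\<close>

text \<open>
  A pair \<open>(i, k)\<close> in \<open>arrows\<close> stands for \<open>i \<leftarrow> k\<close>. Dashed and full lines are
  stored in both directions.
\<close>

record 'a mixed_graph =
  nodes :: "'a set"
  arrows :: "('a \<times> 'a) set"
  dashed :: "('a \<times> 'a) set"
  full :: "('a \<times> 'a) set"

definition is_ancestor :: "'a mixed_graph \<Rightarrow> 'a \<Rightarrow> 'a \<Rightarrow> bool" where
  "is_ancestor G k i \<longleftrightarrow> (i, k) \<in> (arrows G)\<^sup>+"

definition parent_graph :: "nat \<Rightarrow> nat mixed_graph \<Rightarrow> bool" where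
  "parent_graph d G \<longleftrightarrow>
     nodes G = {1..d} \<and>
     arrows G \<subseteq> {(i, k). i \<in> {1..d} \<and> k \<in> {1..d} \<and> i < k} \<and>
     dashed G = {} \<and> full G = {} \<and>
     (\<forall>i\<in>{1..d}. \<forall>k\<in>{1..d}. (i, k) \<in> (arrows G \<union> (arrows G)\<inverse>)\<^sup>*)"

definition edge_matrix :: "'a mixed_graph \<Rightarrow> 'a matrix" where
  "edge_matrix G = (\<lambda>i k. if i = k \<or> (i, k) \<in> arrows G then 1 else 0)"

definition summary_graph :: "'a set \<Rightarrow> 'a set \<Rightarrow> 'a mixed_graph \<Rightarrow> bool" where
  "summary_graph u v G \<longleftrightarrow>
     finite u \<and> finite v \<and> u \<inter> v = {} \<and> nodes G = u \<union> v \<and>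
     arrows G \<subseteq> u \<times> (u \<union> v) \<and> acyclic (arrows G \<inter> u \<times> u) \<and>
     dashed G \<subseteq> u \<times> u \<and> sym (dashed G) \<and> irrefl (dashed G) \<and>
     full G \<subseteq> v \<times> v \<and> sym (full G) \<and> irrefl (full G)"

definition graph_of_matrices ::
    "'a set \<Rightarrow> 'a set \<Rightarrow> 'a matrix \<Rightarrow> 'a matrix \<Rightarrow> 'a matrix \<Rightarrow> 'a matrix \<Rightarrow> 'a mixed_graph" where
  "graph_of_matrices u v Huu Huv Wuu Svv =
     \<lparr> nodes = u \<union> v,
       arrows = {(i, k). i \<in> u \<and> k \<in> u \<and> i \<noteq> k \<and> Huu i k = 1}
              \<union> {(i, k). i \<in> u \<and> k \<in> v \<and> Huv i k = 1},
       dashed = {(i, k). i \<in> u \<and> k \<in> u \<and> i \<noteq> k \<and> Wuu i k = 1},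
       full = {(i, k). i \<in> v \<and> k \<in> v \<and> i \<noteq> k \<and> Svv i k = 1} \<rparr>"

section \<open>Paths and implied independences\<close>

text \<open>
  Two nodes may be coupled by both an arrow and a dashed line, so a path has to record which
  edge it uses. The constructors describe an edge as traversed from left to right:
  \<open>\<rightarrow>\<close>, \<open>\<leftarrow>\<close>, dashed line, full line.
\<close>

datatype edge_kind = Forward | Backward | Dashed | Full

fun joins :: "'a mixed_graph \<Rightarrow> edge_kind \<Rightarrow> 'a \<Rightarrow> 'a \<Rightarrow> bool" where
  "joins G Forward i k \<longleftrightarrow> (k, i) \<in> arrows G"
| "joins G Backward i k \<longleftrightarrow> (i, k) \<in> arrows G"
| "joins G Dashed i k \<longleftrightarrow> (i, k) \<in> dashed G"
| "joins G Full i k \<longleftrightarrow> (i, k) \<in> full G"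

text \<open>
  The path with nodes \<open>ns\<close> and edges \<open>es\<close>: the edge \<open>es ! m\<close> runs from \<open>ns ! m\<close> to
  \<open>ns ! Suc m\<close>, and the inner nodes are \<open>ns ! m\<close> for \<open>0 < m < length es\<close>.
\<close>

definition is_path :: "'a mixed_graph \<Rightarrow> 'a list \<Rightarrow> edge_kind list \<Rightarrow> bool" where
  "is_path G ns es \<longleftrightarrow>
     es \<noteq> [] \<and> length ns = Suc (length es) \<and> set ns \<subseteq> nodes G \<and>
     distinct (butlast (tl ns)) \<and>
     (\<forall>m < length es. joins G (es ! m) (ns ! m) (ns ! Suc m))"

text \<open>Whether an inner node is a collision node, by the path edges to its left and right.\<close>

definition collision :: "edge_kind \<Rightarrow> edge_kind \<Rightarrow> bool" where
  "collision e e' \<longleftrightarrow>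
     (e = Forward \<and> e' = Backward) \<or> (e = Forward \<and> e' = Dashed) \<or>
     (e = Dashed \<and> e' = Backward) \<or> (e = Dashed \<and> e' = Dashed)"

definition active_path :: "'a mixed_graph \<Rightarrow> 'a set \<Rightarrow> 'a list \<Rightarrow> edge_kind list \<Rightarrow> bool" where
  "active_path G c ns es \<longleftrightarrow> is_path G ns es \<and>
     (\<forall>m. 0 < m \<and> m < length es \<longrightarrow>
        (if collision (es ! (m - 1)) (es ! m)
         then ns ! m \<in> c \<or> (\<exists>j\<in>c. is_ancestor G (ns ! m) j)
         else ns ! m \<notin> c))"

text \<open>Meant for pairwise disjoint \<open>\<alpha>\<close>, \<open>\<beta>\<close>, \<open>c\<close> with nonempty \<open>\<alpha>\<close> and \<open>\<beta>\<close>.\<close>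

definition implies_indep :: "'a mixed_graph \<Rightarrow> 'a set \<Rightarrow> 'a set \<Rightarrow> 'a set \<Rightarrow> bool" where
  "implies_indep G \<alpha> \<beta> c \<longleftrightarrow>
     \<not> (\<exists>ns es. active_path G c ns es \<and> hd ns \<in> \<alpha> \<and> last ns \<in> \<beta>)"

end

theory Submission
  imports Defs
begin

text \<open>
  Whether a walk may go on at a node depends only on the node and on whether it was entered with
  an arrowhead. So independence is reachability in a graph of such states: cutting loops out of an
  open walk keeps it open, and detours down to the conditioning set allow us to demand that every
  collision node is in this set. The summary graph is then reached in two steps.

  Conditioning on \<open>C\<close>: walks from \<open>O\<close> cannot enter \<open>R\<close> except against arrows, and a node of \<open>F\<close>
  is an ancestor of \<open>C\<close>, so that it is open as a collision node as well as otherwise. What a walk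
  does inside \<open>R\<close> is therefore recorded by full lines between nodes of \<open>F\<close> that are adjacent or
  have a common child in \<open>R\<close>.

  Marginalising over \<open>M\<close>: collision nodes are now in the conditioning set, hence never in \<open>M\<close>, and a
  walk splits into segments with inner noncollision nodes in \<open>M\<close>. According to the arrowheads at
  the ends, these segments are the arrows, dashed and full lines of the summary graph; up to the
  irrelevant diagonal entries they are what the partial closures compute, since
  the inverse of \<open>n I - X\<close> is a positive combination of all powers of \<open>X\<close>.
\<close>

section \<open>Partial closure as reachability\<close>

text \<open>Only inner nodes are confined to \<open>a\<close>; the ends are arbitrary, and at least
  one step is taken. This is the combinatorial content of an entry of \<open>zer\<close>.\<close>

inductive via :: "'a set \<Rightarrow> ('a \<times> 'a) set \<Rightarrow> 'a \<Rightarrow> 'a \<Rightarrow> bool" for a r where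
  edge: "(i, k) \<in> r \<Longrightarrow> via a r i k"
| extend: "via a r i j \<Longrightarrow> j \<in> a \<Longrightarrow> (j, k) \<in> r \<Longrightarrow> via a r i k"

lemma via_trans:
  assumes "via a r j k" "via a r i j" "j \<in> a"
  shows "via a r i k"
  using assms by (induction rule: via.induct) (auto intro: via.intros)

lemma via_converse: "via a (r\<inverse>) k i \<longleftrightarrow> via a r i k"
proof -
  have "via a (r\<inverse>) k i" if "via a r i k" for r :: "('a \<times> 'a) set" and i k
    using that
    by (induction rule: via.induct) (auto intro: via.intros via_trans[OF _ via.edge])
  from this[of r i k] this[of "r\<inverse>" k i] show ?thesis by auto
qed

lemma via_in_trancl: "via a r i k \<Longrightarrow> (i, k) \<in> r\<^sup>+"
  by (induction rule: via.induct) auto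

text \<open>The unit diagonal of an edge matrix contributes only loops, which can be cut out of a
  walk between distinct ends.\<close>

lemma via_reflcl: "via a (r\<^sup>=) i k \<Longrightarrow> i \<noteq> k \<Longrightarrow> via a r i k"
  by (induction rule: via.induct) (auto intro: via.intros)

lemma via_mono: "via a r i k \<Longrightarrow> r \<subseteq> r' \<Longrightarrow> via a r' i k"
  by (induction rule: via.induct) (auto intro: via.intros)

lemma rtrancl_via:
  assumes "(j, k) \<in> (r \<inter> a \<times> a)\<^sup>*" "via a r i j"
  shows "via a r i k"
  using assms by (induction rule: rtrancl_induct) (auto intro: via.intros)

lemma via_iff_first:
  "via a r i k \<longleftrightarrow> (i, k) \<in> r \<or> (\<exists>j\<in>a. (i, j) \<in> r \<and> via a r j k)"
proof
  assume "via a r i k"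
  then show "(i, k) \<in> r \<or> (\<exists>j\<in>a. (i, j) \<in> r \<and> via a r j k)"
    by induction (auto intro: via.intros)
qed (auto intro: via.edge via_trans)

lemma via_iff_rtrancl_left:
  assumes "k \<in> a"
  shows "via a r i k \<longleftrightarrow> (\<exists>j\<in>a. (i, j) \<in> r \<and> (j, k) \<in> (r \<inter> a \<times> a)\<^sup>*)"
proof
  assume "via a r i k"
  then show "\<exists>j\<in>a. (i, j) \<in> r \<and> (j, k) \<in> (r \<inter> a \<times> a)\<^sup>*"
    using assms
  proof induction
    case (extend i j k)
    then have "(j, k) \<in> r \<inter> a \<times> a" by simp
    then show ?case using extend by (meson rtrancl.rtrancl_into_rtrancl)
  qed blast
next
  assume "\<exists>j\<in>a. (i, j) \<in> r \<and> (j, k) \<in> (r \<inter> a \<times> a)\<^sup>*"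
  then obtain j where "(i, j) \<in> r" "(j, k) \<in> (r \<inter> a \<times> a)\<^sup>*" by blast
  then show "via a r i k" using rtrancl_via[OF _ via.edge] by fast
qed

lemma rtrancl_iff_via:
  assumes "i \<in> a" "k \<in> a" "\<And>j. j \<in> a \<Longrightarrow> (j, j) \<in> r"
  shows "(i, k) \<in> (r \<inter> a \<times> a)\<^sup>* \<longleftrightarrow> via a r i k"
proof
  assume "(i, k) \<in> (r \<inter> a \<times> a)\<^sup>*"
  then show "via a r i k" using assms by (auto intro: rtrancl_via via.intros)
next
  assume "via a r i k"
  then show "(i, k) \<in> (r \<inter> a \<times> a)\<^sup>*"
    using assms(1,2) by induction (auto intro: rtrancl.rtrancl_into_rtrancl)
qed

section \<open>Neumann series for the inverse behind a partial closure\<close>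

primrec mpow :: "'a set \<Rightarrow> 'a matrix \<Rightarrow> nat \<Rightarrow> 'a matrix" where
  "mpow a X 0 = mident"
| "mpow a X (Suc m) = mmul a X (mpow a X m)"

lemma mmul_assoc: "mmul b (mmul a X Y) W = mmul a X (mmul b Y W)"
  unfolding mmul_def
  by (auto simp: sum_distrib_left sum_distrib_right mult.assoc intro!: ext sum.swap)

lemma mmul_mident_left: "finite a \<Longrightarrow> i \<in> a \<Longrightarrow> mmul a mident X i k = X i k"
  by (simp add: mmul_def mident_def if_distribR sum.If_cases if_distrib cong: if_cong)

lemma mmul_mident_right: "finite a \<Longrightarrow> k \<in> a \<Longrightarrow> mmul a X mident i k = X i k"
  by (simp add: mmul_def mident_def if_distrib cong: if_cong)

lemma mpow_commute:
  assumes "finite a" "i \<in> a" "k \<in> a"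
  shows "mmul a (mpow a X m) X i k = mpow a X (Suc m) i k"
  using assms(2)
proof (induction m arbitrary: i)
  case 0
  then show ?case using assms by (simp add: mmul_mident_left mmul_mident_right)
next
  case (Suc m)
  have "mmul a (mpow a X (Suc m)) X i k = mmul a X (mmul a (mpow a X m) X) i k"
    by (simp add: mmul_assoc)
  also have "\<dots> = mmul a X (mpow a X (Suc m)) i k"
    unfolding mmul_def[of a X] using Suc by (auto intro!: sum.cong)
  finally show ?case by simp
qed

locale binary_matrix =
  fixes a :: "'a set" and X :: "'a matrix"
  assumes fin: "finite a" and binary: "i \<in> a \<Longrightarrow> k \<in> a \<Longrightarrow> X i k \<in> {0, 1}"
begin

definition rel where "rel = {(i, k). i \<in> a \<and> k \<in> a \<and> X i k \<noteq> 0}"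

lemma mpow_nonneg: "i \<in> a \<Longrightarrow> k \<in> a \<Longrightarrow> 0 \<le> mpow a X m i k"
proof (induction m arbitrary: i)
  case (Suc m)
  have "0 \<le> X i j * mpow a X m j k" if "j \<in> a" for j
    using binary[of i j] Suc that by auto
  then show ?case by (auto simp: mmul_def intro!: sum_nonneg)
qed (auto simp: mident_def)

lemma mpow_le: "i \<in> a \<Longrightarrow> k \<in> a \<Longrightarrow> mpow a X m i k \<le> real (card a) ^ m"
proof (induction m arbitrary: i)
  case (Suc m)
  have "X i j * mpow a X m j k \<le> real (card a) ^ m" if "j \<in> a" for j
    using binary[of i j] Suc that by auto
  then have "(\<Sum>j\<in>a. X i j * mpow a X m j k) \<le> real (card a) * real (card a) ^ m"
    by (rule sum_bounded_above)
  then show ?case by (simp add: mmul_def)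
qed (auto simp: mident_def)

text \<open>Nonnegative summands cannot cancel, so a single walk suffices to make an entry
  nonzero.\<close>

lemma mpow_nonzero_iff:
  "i \<in> a \<Longrightarrow> k \<in> a \<Longrightarrow> mpow a X m i k \<noteq> 0 \<longleftrightarrow> (i, k) \<in> rel ^^ m"
proof (induction m arbitrary: i)
  case (Suc m)
  have "mpow a X (Suc m) i k = 0 \<longleftrightarrow> (\<forall>j\<in>a. X i j * mpow a X m j k = 0)"
    unfolding mpow.simps mmul_def
  proof (rule sum_nonneg_eq_0_iff[OF fin])
    fix j assume "j \<in> a"
    then show "0 \<le> X i j * mpow a X m j k"
      using binary[of i j] mpow_nonneg[of j k m] Suc by auto
  qed
  also have "\<dots> \<longleftrightarrow> \<not> (\<exists>j. (i, j) \<in> rel \<and> (j, k) \<in> rel ^^ m)"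
    using Suc by (auto simp: rel_def)
  finally show ?case by (auto simp: relpow_commute[symmetric] simp del: mpow.simps)
qed (auto simp: mident_def)

definition shifted :: "'a matrix" where
  "shifted = (\<lambda>i k. real (card a + 1) * mident i k - X i k)"

text \<open>With \<open>n = card a + 1\<close> this is the expansion of the inverse of
  \<open>n I - X\<close>. It converges because the entries of \<open>X^m\<close> are at most
  \<open>card a ^ m\<close>.\<close>

definition neumann :: "'a matrix" where
  "neumann = (\<lambda>i k. \<Sum>m. mpow a X m i k / real (card a + 1) ^ Suc m)"

lemma summable_neumann:
  assumes "i \<in> a" "k \<in> a"
  shows "summable (\<lambda>m. mpow a X m i k / real (card a + 1) ^ Suc m)"
proof (rule summable_comparison_test')
  show "summable (\<lambda>m. (real (card a) / real (card a + 1)) ^ m)"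
    by (rule summable_geometric) auto
  fix m :: nat
  have "mpow a X m i k / real (card a + 1) ^ Suc m \<le> mpow a X m i k / real (card a + 1) ^ m"
    using mpow_nonneg[OF assms, of m] by (intro divide_left_mono) auto
  also have "\<dots> \<le> (real (card a) / real (card a + 1)) ^ m"
    using mpow_le[OF assms, of m] by (simp add: power_divide divide_right_mono)
  finally show "norm (mpow a X m i k / real (card a + 1) ^ Suc m)
      \<le> (real (card a) / real (card a + 1)) ^ m"
    using mpow_nonneg[OF assms, of m] by simp
qed

text \<open>Both terms are the series of \<open>X^m / n^m\<close>, the second one without its head;
  the power zero is left over.\<close>

lemma neumann_telescope:
  assumes "i \<in> a" "k \<in> a"
  shows "real (card a + 1) * neumann i k
           - (\<Sum>m. mpow a X (Suc m) i k / real (card a + 1) ^ Suc m) = mident i k"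
proof -
  let ?n = "real (card a + 1)"
  have s: "summable (\<lambda>m. mpow a X m i k / ?n ^ m)"
    using summable_mult[OF summable_neumann[OF assms], of ?n] by simp
  have "?n * neumann i k = (\<Sum>m. mpow a X m i k / ?n ^ m)"
    unfolding neumann_def using suminf_mult[OF summable_neumann[OF assms], of ?n] by simp
  then show ?thesis using suminf_split_head[OF s] by simp
qed

lemma neumann_inverse:
  assumes "i \<in> a" "k \<in> a"
  shows "mmul a shifted neumann i k = mident i k" "mmul a neumann shifted i k = mident i k"
proof -
  let ?n = "real (card a + 1)"
  have "mmul a X neumann i k = (\<Sum>j\<in>a. \<Sum>m. X i j * (mpow a X m j k / ?n ^ Suc m))"
    unfolding mmul_def neumann_def
    by (intro sum.cong refl suminf_mult[symmetric] summable_neumann assms)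
  also have "\<dots> = (\<Sum>m. \<Sum>j\<in>a. X i j * (mpow a X m j k / ?n ^ Suc m))"
    by (rule suminf_sum[symmetric]) (intro summable_mult summable_neumann assms)
  also have "\<dots> = (\<Sum>m. mpow a X (Suc m) i k / ?n ^ Suc m)"
    by (simp add: mmul_def sum_divide_distrib)
  finally have 1: "mmul a X neumann i k = (\<Sum>m. mpow a X (Suc m) i k / ?n ^ Suc m)" .
  have "mmul a shifted neumann i k = ?n * mmul a mident neumann i k - mmul a X neumann i k"
    by (simp add: mmul_def shifted_def left_diff_distrib sum_subtractf sum_distrib_left mult.assoc)
  then show "mmul a shifted neumann i k = mident i k"
    using neumann_telescope[OF assms] 1 fin assms by (simp add: mmul_mident_left)
  have "mmul a neumann X i k = (\<Sum>j\<in>a. \<Sum>m. (mpow a X m i j / ?n ^ Suc m) * X j k)"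
    unfolding mmul_def neumann_def
    by (intro sum.cong refl suminf_mult2 summable_neumann assms)
  also have "\<dots> = (\<Sum>m. \<Sum>j\<in>a. (mpow a X m i j / ?n ^ Suc m) * X j k)"
    by (rule suminf_sum[symmetric]) (intro summable_mult2 summable_neumann assms)
  also have "\<dots> = (\<Sum>m. mmul a (mpow a X m) X i k / ?n ^ Suc m)"
    by (simp add: mmul_def sum_divide_distrib)
  finally have 2: "mmul a neumann X i k = (\<Sum>m. mpow a X (Suc m) i k / ?n ^ Suc m)"
    using fin assms by (simp add: mpow_commute del: mpow.simps)
  have "mmul a neumann shifted i k = ?n * mmul a neumann mident i k - mmul a neumann X i k"
    by (simp add: mmul_def shifted_def right_diff_distrib sum_subtractf sum_distrib_left ac_simps)
  then show "mmul a neumann shifted i k = mident i k"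
    using neumann_telescope[OF assms] 2 fin assms by (simp add: mmul_mident_right)
qed

text \<open>\<open>minverse\<close> is an arbitrary choice, but on \<open>a\<close> inverses are
  unique: by associativity, a left inverse agrees with a right inverse.\<close>

lemma minverse_eq_neumann:
  assumes ik: "i \<in> a" "k \<in> a"
  shows "minverse a shifted i k = neumann i k"
proof -
  let ?Y = "minverse a shifted"
  have "\<forall>i\<in>a. \<forall>k\<in>a. mmul a shifted ?Y i k = mident i k \<and> mmul a ?Y shifted i k = mident i k"
    unfolding minverse_def by (rule someI[of _ neumann]) (auto simp: neumann_inverse)
  then have Y: "mmul a ?Y shifted i j = mident i j" if "j \<in> a" for j
    using ik that by blast
  have "?Y i k = mmul a ?Y mident i k"
    using fin ik by (simp add: mmul_mident_right)
  also have "\<dots> = mmul a ?Y (mmul a shifted neumann) i k"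
    unfolding mmul_def[of a ?Y] using neumann_inverse(1) ik by (auto intro!: sum.cong)
  also have "\<dots> = mmul a (mmul a ?Y shifted) neumann i k"
    by (simp add: mmul_assoc)
  also have "\<dots> = mmul a mident neumann i k"
    unfolding mmul_def[of a _ neumann] using Y by (auto intro!: sum.cong)
  finally show ?thesis using fin ik by (simp add: mmul_mident_left)
qed

lemma neumann_nonzero_iff:
  assumes ik: "i \<in> a" "k \<in> a"
  shows "neumann i k \<noteq> 0 \<longleftrightarrow> (i, k) \<in> rel\<^sup>*"
proof -
  have "neumann i k = 0 \<longleftrightarrow> (\<forall>m. mpow a X m i k / real (card a + 1) ^ Suc m = 0)"
    unfolding neumann_def
    by (rule suminf_eq_zero_iff[OF summable_neumann[OF ik]])
       (use mpow_nonneg[OF ik] in auto)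
  then show ?thesis
    using mpow_nonzero_iff[OF ik] by (auto simp: rtrancl_power)
qed

lemma pinverse_eq:
  assumes "i \<in> a" "k \<in> a"
  shows "pinverse a X i k = of_bool ((i, k) \<in> rel\<^sup>*)"
  using minverse_eq_neumann[OF assms] neumann_nonzero_iff[OF assms]
  unfolding pinverse_def In_def shifted_def by auto

end

text \<open>As all entries are nonnegative, \<open>In\<close> of sums and products of blocks
  expresses the existence of a walk; the four blocks correspond to the positions of its ends. The
  diagonal on \<open>a\<close> lets the empty walk of a reflexive closure count as a loop.\<close>

lemma zer_eq_via:
  fixes X :: "'a matrix"
  assumes "finite a" "a \<inter> b = {}" "i \<in> a \<union> b" "k \<in> a \<union> b"
    and bin: "\<And>i k. i \<in> a \<union> b \<Longrightarrow> k \<in> a \<union> b \<Longrightarrow> X i k \<in> {0, 1}"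
    and diag: "\<And>i. i \<in> a \<Longrightarrow> X i i \<noteq> 0"
  shows "zer a b X i k = of_bool (via a {(i, k). X i k \<noteq> 0} i k)"
proof (cases "a = {}")
  case True
  have "via {} r i k \<longleftrightarrow> (i, k) \<in> r" for r :: "('a \<times> 'a) set"
    by (auto elim: via.cases intro: via.intros)
  then show ?thesis using True bin[OF assms(3,4)] by (auto simp: zer_def)
next
  case False
  let ?r = "{(i, k). X i k \<noteq> 0}"
  interpret binary_matrix a "sub X a a"
    by unfold_locales (use assms in \<open>auto simp: sub_def\<close>)
  have rel: "rel = ?r \<inter> a \<times> a" unfolding rel_def by (auto simp: sub_def)
  have nn: "X i k \<ge> 0" if "i \<in> a \<union> b" "k \<in> a \<union> b" for i k
    using bin[OF that] by auto
  define I where "I = pinverse a (sub X a a)"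
  have I: "I j k = of_bool ((j, k) \<in> rel\<^sup>*)" if "j \<in> a" "k \<in> a" for j k
    unfolding I_def using pinverse_eq that by blast
  have ab: "mmul a I (sub X a b) i k \<noteq> 0 \<longleftrightarrow> via a ?r i k"
    if "i \<in> a" "k \<in> b" for i k
  proof -
    have "mmul a I (sub X a b) i k = 0 \<longleftrightarrow> (\<forall>j\<in>a. I i j * sub X a b j k = 0)"
      unfolding mmul_def using that nn I \<open>finite a\<close>
      by (intro sum_nonneg_eq_0_iff) (auto simp: sub_def)
    also have "\<dots> \<longleftrightarrow> \<not> via a ?r i k"
    proof -
      have "via a ?r i k \<longleftrightarrow> (\<exists>j\<in>a. (i, j) \<in> rel\<^sup>* \<and> (j, k) \<in> ?r)"
      proof
        assume "via a ?r i k"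
        \<comment> \<open>The loop at \<open>i\<close> provides the inner node \<open>j = i\<close>
          when the walk is a single edge.\<close>
        moreover have "via a ?r i i" using that diag by (auto intro: via.edge)
        ultimately obtain j where "j \<in> a" "via a ?r i j" "(j, k) \<in> ?r"
          using \<open>i \<in> a\<close> by cases auto
        then show "\<exists>j\<in>a. (i, j) \<in> rel\<^sup>* \<and> (j, k) \<in> ?r"
          using that rtrancl_iff_via[of i a _ ?r] diag unfolding rel by auto
      next
        assume "\<exists>j\<in>a. (i, j) \<in> rel\<^sup>* \<and> (j, k) \<in> ?r"
        then show "via a ?r i k"
          using that rtrancl_iff_via[of i a _ ?r] diag unfolding rel by (auto intro: via.extend)
      qed
      then show ?thesis using that I by (auto simp: sub_def)
    qed
    finally show ?thesis by auto
  qed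
  have nnI: "mmul a I (sub X a b) j k \<ge> 0" if "j \<in> a" "k \<in> b" for j k
    unfolding mmul_def using that nn I by (auto intro!: sum_nonneg simp: sub_def)
  consider "i \<in> a" "k \<in> a" | "i \<in> a" "k \<in> b" | "i \<in> b" "k \<in> a" | "i \<in> b" "k \<in> b"
    using assms by blast
  then show ?thesis
  proof cases
    case 1
    then show ?thesis
      using False I[OF 1] rtrancl_iff_via[of i a k ?r] diag rel
      by (auto simp: zer_def Let_def In_def I_def[symmetric])
  next
    case 2
    then have "k \<notin> a" using assms by auto
    then show ?thesis using False 2 ab[OF 2]
      by (auto simp: zer_def Let_def In_def I_def[symmetric])
  next
    case 3
    then have "i \<notin> a" "k \<notin> b" using assms by auto
    have "mmul a (sub X b a) I i k = 0 \<longleftrightarrow> (\<forall>j\<in>a. sub X b a i j * I j k = 0)"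
      unfolding mmul_def using 3 nn I \<open>finite a\<close>
      by (intro sum_nonneg_eq_0_iff) (auto simp: sub_def)
    also have "\<dots> \<longleftrightarrow> \<not> (\<exists>j\<in>a. (i, j) \<in> ?r \<and> (j, k) \<in> rel\<^sup>*)"
      using 3 I by (auto simp: sub_def)
    also have "(\<exists>j\<in>a. (i, j) \<in> ?r \<and> (j, k) \<in> rel\<^sup>*) \<longleftrightarrow> via a ?r i k"
      unfolding rel using 3 by (simp only: via_iff_rtrancl_left)
    finally show ?thesis using False 3 \<open>i \<notin> a\<close> \<open>k \<notin> b\<close>
      by (auto simp: zer_def Let_def In_def I_def[symmetric])
  next
    case 4
    then have "i \<notin> a" "k \<notin> a" using assms by auto
    let ?m = "mmul a (sub X b a) (mmul a I (sub X a b)) i k"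
    have "?m = 0 \<longleftrightarrow> (\<forall>j\<in>a. sub X b a i j * mmul a I (sub X a b) j k = 0)"
      unfolding mmul_def[of a "sub X b a"] using 4 nn nnI \<open>finite a\<close>
      by (intro sum_nonneg_eq_0_iff) (auto simp: sub_def)
    also have "\<dots> \<longleftrightarrow> \<not> (\<exists>j\<in>a. (i, j) \<in> ?r \<and> via a ?r j k)"
      using 4 ab by (auto simp: sub_def)
    finally have m: "?m = 0 \<longleftrightarrow> \<not> (\<exists>j\<in>a. (i, j) \<in> ?r \<and> via a ?r j k)" .
    have "?m \<ge> 0" unfolding mmul_def[of a "sub X b a"] using 4 nn nnI
      by (auto intro!: sum_nonneg simp: sub_def)
    then have "madd (sub X b b) (mmul a (sub X b a) (mmul a I (sub X a b))) i k \<noteq> 0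
        \<longleftrightarrow> (i, k) \<in> ?r \<or> ?m \<noteq> 0"
      using 4 nn[of i k] by (auto simp: madd_def sub_def)
    also have "\<dots> \<longleftrightarrow> via a ?r i k"
      unfolding via_iff_first[of a ?r i k] using m by blast
    finally show ?thesis using False 4 \<open>i \<notin> a\<close> \<open>k \<notin> a\<close>
      by (auto simp: zer_def Let_def In_def I_def[symmetric])
  qed
qed

section \<open>Walks in mixed graphs\<close>

text \<open>
  \<open>E x b y b'\<close> is an edge between \<open>x\<close> and \<open>y\<close>; the flags tell whether it has an arrowhead (or is
  dashed) at \<open>x\<close> and at \<open>y\<close>. Likewise \<open>reach E Y Z a x b\<close> records whether the walk from \<open>a\<close>
  enters \<open>x\<close> with an arrowhead, since only this decides how it may go on.
  Collision nodes have to be in \<open>Y\<close>, other inner nodes outside \<open>Z\<close>. The start counts as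
  entered without arrowhead, which is harmless for \<open>a \<notin> Z\<close>.
\<close>

inductive reach :: "('a \<Rightarrow> bool \<Rightarrow> 'a \<Rightarrow> bool \<Rightarrow> bool) \<Rightarrow> 'a set \<Rightarrow> 'a set \<Rightarrow> 'a \<Rightarrow> 'a \<Rightarrow> bool \<Rightarrow> bool"
  for E Y Z a where
  start: "reach E Y Z a a False"
| step: "reach E Y Z a x b \<Longrightarrow> E x b1 y b2 \<Longrightarrow> (if b \<and> b1 then x \<in> Y else x \<notin> Z) \<Longrightarrow>
    reach E Y Z a y b2"

section \<open>From active paths to reachable states\<close>

fun lhead :: "edge_kind \<Rightarrow> bool" where
  "lhead Forward = False" | "lhead Backward = True" | "lhead Dashed = True" | "lhead Full = False"

fun rhead :: "edge_kind \<Rightarrow> bool" where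
  "rhead Forward = True" | "rhead Backward = False" | "rhead Dashed = True" | "rhead Full = False"

definition edge_rel :: "'a mixed_graph \<Rightarrow> 'a \<Rightarrow> bool \<Rightarrow> 'a \<Rightarrow> bool \<Rightarrow> bool" where
  "edge_rel G x b y b' \<longleftrightarrow> (\<exists>e. joins G e x y \<and> b = lhead e \<and> b' = rhead e)"

lemma edge_rel_simps [simp]:
  "edge_rel G x False y True \<longleftrightarrow> (y, x) \<in> arrows G"
  "edge_rel G x True y False \<longleftrightarrow> (x, y) \<in> arrows G"
  "edge_rel G x True y True \<longleftrightarrow> (x, y) \<in> dashed G"
  "edge_rel G x False y False \<longleftrightarrow> (x, y) \<in> full G"
  unfolding edge_rel_def by (metis edge_kind.exhaust joins.simps lhead.simps rhead.simps)+

text \<open>Two flags per edge lose nothing: for collisions, a dashed line acts like an arrowhead at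
  both ends and a full line like none.\<close>

lemma collision_iff: "collision e e' \<longleftrightarrow> rhead e \<and> lhead e'"
  by (cases e; cases e') (auto simp: collision_def)

definition ancs :: "'a mixed_graph \<Rightarrow> 'a set \<Rightarrow> 'a set" where
  "ancs G c = {x. x \<in> c \<or> (\<exists>j\<in>c. is_ancestor G x j)}"

text \<open>An active path freed of distinct inner nodes, of a nonempty edge list and of the
  membership of its nodes in the graph.\<close>

definition open_walk :: "'a mixed_graph \<Rightarrow> 'a set \<Rightarrow> 'a list \<Rightarrow> edge_kind list \<Rightarrow> bool" where
  "open_walk G c ns es \<longleftrightarrow> length ns = Suc (length es) \<and>
     (\<forall>m < length es. joins G (es ! m) (ns ! m) (ns ! Suc m)) \<and>
     (\<forall>m. 0 < m \<and> m < length es \<longrightarrow>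
        (if rhead (es ! (m - 1)) \<and> lhead (es ! m) then ns ! m \<in> ancs G c else ns ! m \<notin> c))"

lemma active_path_open_walk: "active_path G c ns es \<Longrightarrow> open_walk G c ns es"
  unfolding active_path_def is_path_def open_walk_def collision_iff ancs_def by simp

text \<open>\<open>reach\<close> treats the start as a noncollision node, hence the assumption on
  \<open>hd ns\<close>.\<close>

lemma open_walk_reach:
  assumes "open_walk G c ns es" "hd ns \<notin> c" "m \<le> length es"
  shows "reach (edge_rel G) (ancs G c) c (hd ns) (ns ! m) (m > 0 \<and> rhead (es ! (m - 1)))"
  using assms(3)
proof (induction m)
  case 0
  have "ns \<noteq> []" using assms by (auto simp: open_walk_def)
  then show ?case by (simp add: hd_conv_nth[symmetric] reach.start)
next
  case (Suc m)
  have "edge_rel G (ns ! m) (lhead (es ! m)) (ns ! Suc m) (rhead (es ! m))"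
    using assms(1) Suc.prems unfolding open_walk_def edge_rel_def by (metis Suc_le_lessD)
  moreover have "if (m > 0 \<and> rhead (es ! (m - 1))) \<and> lhead (es ! m)
      then ns ! m \<in> ancs G c else ns ! m \<notin> c"
  proof (cases "m = 0")
    case True
    then show ?thesis using assms(2) \<open>open_walk G c ns es\<close>
      by (cases ns) (auto simp: open_walk_def)
  next
    case False
    then show ?thesis using assms(1) Suc.prems unfolding open_walk_def by simp
  qed
  ultimately show ?case using reach.step[OF Suc.IH] Suc.prems by fastforce
qed

lemma reach_open_walk:
  assumes "reach (edge_rel G) (ancs G c) c a x b"
  shows "\<exists>ns es. open_walk G c ns es \<and> hd ns = a \<and> last ns = x \<and>
           b = (es \<noteq> [] \<and> rhead (last es))"
  using assms
proof induction
  case start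
  show ?case by (rule exI[of _ "[a]"], rule exI[of _ "[]"]) (simp add: open_walk_def)
next
  case (step x b b1 y b2)
  then obtain ns es where w: "open_walk G c ns es" "hd ns = a" "last ns = x"
    "b = (es \<noteq> [] \<and> rhead (last es))" by blast
  obtain e where e: "joins G e x y" "b1 = lhead e" "b2 = rhead e"
    using step.hyps(2) unfolding edge_rel_def by blast
  have len: "length ns = Suc (length es)" using w by (simp add: open_walk_def)
  then have "ns \<noteq> []" by auto
  then have nth: "ns ! length es = x" "ns \<noteq> []"
    using w(3) len by (simp_all add: last_conv_nth)
  have "open_walk G c (ns @ [y]) (es @ [e])"
    unfolding open_walk_def
  proof (intro conjI allI impI)
    show "length (ns @ [y]) = Suc (length (es @ [e]))" using len by simp
    fix m assume "m < length (es @ [e])"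
    then show "joins G ((es @ [e]) ! m) ((ns @ [y]) ! m) ((ns @ [y]) ! Suc m)"
      using w(1) e len nth unfolding open_walk_def by (auto simp: nth_append less_Suc_eq)
  next
    fix m assume m: "0 < m \<and> m < length (es @ [e])"
    show "if rhead ((es @ [e]) ! (m - 1)) \<and> lhead ((es @ [e]) ! m)
      then (ns @ [y]) ! m \<in> ancs G c else (ns @ [y]) ! m \<notin> c"
    proof (cases "m = length es")
      case True
      then have "(es @ [e]) ! (m - 1) = last es" "es \<noteq> []"
        using m by (auto simp: nth_append last_conv_nth)
      then show ?thesis using True step.hyps(3) w(4) e nth len by (simp add: nth_append)
    next
      case False
      moreover from this m have "m - 1 < length es" "m < length es" by auto
      ultimately show ?thesis using m w(1) len unfolding open_walk_def
        by (simp add: nth_append)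
    qed
  qed
  moreover have "hd (ns @ [y]) = a" using w nth by simp
  ultimately show ?case using e
    by (intro exI[of _ "ns @ [y]"] exI[of _ "es @ [e]"]) simp
qed

text \<open>Arrows point only to nodes of \<open>u\<close>, so a directed cycle would stay inside
  \<open>u\<close>.\<close>

lemma summary_graph_acyclic:
  assumes "summary_graph u v G"
  shows "acyclic (arrows G)"
proof (rule acyclicI, intro allI notI)
  let ?r = "arrows G \<inter> u \<times> u"
  have r: "arrows G \<subseteq> u \<times> (u \<union> v)" "u \<inter> v = {}" "acyclic ?r"
    using assms by (auto simp: summary_graph_def)
  have step: "(i, k) \<in> ?r\<^sup>+" if "(i, k) \<in> (arrows G)\<^sup>+" "k \<in> u" for i k
    using that
  proof (induction rule: trancl_induct)
    case (base y)
    then show ?case using r by auto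
  next
    case (step y z)
    then have "(y, z) \<in> ?r" "y \<in> u" using r by auto
    then show ?case using step by (meson trancl.trancl_into_trancl)
  qed
  fix x assume x: "(x, x) \<in> (arrows G)\<^sup>+"
  then have "x \<in> u" using r by (meson SigmaD1 subsetD tranclD)
  then show False using step[OF x] r(3) by (simp add: acyclic_def)
qed

text \<open>Only the junction is critical, and only if it becomes a collision node. If it had no
  descendant in \<open>c\<close> and were not in \<open>c\<close> itself, the loop would have to
  leave it along an arrow and could never turn round at a collision, hence would be a directed
  cycle.\<close>

lemma open_walk_shorten:
  assumes G: "summary_graph u v G" and w: "open_walk G c ns es"
    and ij: "0 < i" "i < j" "j < length es" "ns ! i = ns ! j"
  shows "open_walk G c (take i ns @ drop j ns) (take i es @ drop j es)"
proof -
  let ?ns = "take i ns @ drop j ns" and ?es = "take i es @ drop j es"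
  have len: "length ns = Suc (length es)"
    and joins: "\<And>m. m < length es \<Longrightarrow> joins G (es ! m) (ns ! m) (ns ! Suc m)"
    and op: "\<And>m. 0 < m \<Longrightarrow> m < length es \<Longrightarrow>
      if rhead (es ! (m - 1)) \<and> lhead (es ! m) then ns ! m \<in> ancs G c else ns ! m \<notin> c"
    using w by (auto simp: open_walk_def)
  \<comment> \<open>At index \<open>i\<close> both halves give the same node, as
    \<open>ns ! i = ns ! j\<close>.\<close>
  have ns: "?ns ! m = (if m \<le> i then ns ! m else ns ! (m + j - i))" if "m \<le> length es - j + i" for m
    using that ij len by (cases "m = i") (auto simp: nth_append not_less min_def add.commute)
  have es: "?es ! m = (if m < i then es ! m else es ! (m + j - i))" if "m < length es - j + i" for m
    using that ij len by (auto simp: nth_append not_less min_def add.commute)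
  let ?x = "ns ! i"
  have middle: "?x \<in> ancs G c" if heads: "rhead (es ! (i - 1))" "lhead (es ! j)"
  proof (rule ccontr)
    assume x: "?x \<notin> ancs G c"
    have anc: "y \<notin> ancs G c" if "(y, ?x) \<in> (arrows G)\<^sup>+" for y
      using x that unfolding ancs_def is_ancestor_def by (auto intro: trancl_trans)
    have vu: "u \<inter> v = {}" "full G \<subseteq> v \<times> v" "arrows G \<subseteq> u \<times> (u \<union> v)" "dashed G \<subseteq> u \<times> u"
      using G by (auto simp: summary_graph_def)
    \<comment> \<open>A node entered with an arrowhead lies in \<open>u\<close> and so has no full
      line; leaving it without arrowhead means following an arrow.\<close>
    have fwd: "es ! m = Forward" if "\<not> lhead (es ! m)" "rhead (es ! (m - 1))" "0 < m" "m < length es" for m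
    proof -
      have "joins G (es ! (m - 1)) (ns ! (m - 1)) (ns ! m)"
        using joins[of "m - 1"] that by simp
      then have "ns ! m \<in> u" using that(2) vu by (cases "es ! (m - 1)") auto
      then have "es ! m \<noteq> Full" using joins[of m] that vu by auto
      then show ?thesis using that(1) by (cases "es ! m") auto
    qed
    have "(ns ! Suc m, ?x) \<in> (arrows G)\<^sup>+ \<and> es ! m = Forward" if "i \<le> m" "m < j" for m
      using that
    proof (induction m rule: dec_induct)
      case base
      have "\<not> lhead (es ! i)" using op[of i] heads x ij by (auto split: if_splits)
      then show ?case using fwd[of i] heads ij joins[of i] by auto
    next
      case (step m)
      then have "\<not> lhead (es ! Suc m)" using op[of "Suc m"] anc[of "ns ! Suc m"] ij
        by (auto split: if_splits)
      then have f: "es ! Suc m = Forward" using fwd[of "Suc m"] step ij by auto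
      then have "(ns ! Suc (Suc m), ns ! Suc m) \<in> arrows G" using joins[of "Suc m"] step ij by auto
      then show ?case using f step by auto
    qed
    from this[of "j - 1"] have "(ns ! j, ?x) \<in> (arrows G)\<^sup>+" using ij by auto
    then show False using summary_graph_acyclic[OF G] ij by (auto simp: acyclic_def)
  qed
  show ?thesis
    unfolding open_walk_def
  proof (intro conjI allI impI)
    show "length ?ns = Suc (length ?es)" using ij len by auto
  next
    fix m assume "m < length ?es"
    then have m: "m < length es - j + i" using ij by auto
    show "joins G (?es ! m) (?ns ! m) (?ns ! Suc m)"
    proof (cases "m < i")
      case True
      then show ?thesis using m ns[of m] ns[of "Suc m"] es[of m] joins[of m] ij by simp
    next
      case False
      then have "?ns ! m = ns ! (m + j - i)" using m ns[of m] ij by auto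
      moreover have "?ns ! Suc m = ns ! Suc (m + j - i)"
        using False m ns[of "Suc m"] ij by (auto simp: Suc_diff_le)
      ultimately show ?thesis using False m es[of m] joins[of "m + j - i"] ij by simp
    qed
  next
    fix m assume "0 < m \<and> m < length ?es"
    then have m: "0 < m" "m < length es - j + i" using ij by auto
    show "if rhead (?es ! (m - 1)) \<and> lhead (?es ! m) then ?ns ! m \<in> ancs G c else ?ns ! m \<notin> c"
    proof (cases m i rule: linorder_cases)
      case less
      then show ?thesis using m ns[of m] es[of m] es[of "m - 1"] op[of m] ij by simp
    next
      case equal
      then have "?es ! (m - 1) = es ! (i - 1)" "?es ! m = es ! j" "?ns ! m = ?x"
        using m ns[of m] es[of m] es[of "m - 1"] by auto
      then show ?thesis using middle op[of i] op[of j] ij by (auto split: if_splits)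
    next
      case greater
      then have "?es ! (m - 1) = es ! (m + j - i - 1)"
        using m es[of "m - 1"] ij by (auto simp: Suc_diff_le)
      then show ?thesis using greater m ns[of m] es[of m] op[of "m + j - i"] ij by simp
    qed
  qed
qed

lemma open_walk_active_path:
  assumes G: "summary_graph u v G" and w: "open_walk G c ns es" "es \<noteq> []"
  shows "\<exists>ns' es'. active_path G c ns' es' \<and> hd ns' = hd ns \<and> last ns' = last ns"
  using w
proof (induction "length es" arbitrary: ns es rule: less_induct)
  case less
  have len: "length ns = Suc (length es)" using less by (simp add: open_walk_def)
  show ?case
  proof (cases "distinct (butlast (tl ns))")
    case True
    have "arrows G \<union> dashed G \<union> full G \<subseteq> nodes G \<times> nodes G"
      using G by (auto simp: summary_graph_def)
    then have edge: "x \<in> nodes G \<and> y \<in> nodes G" if "joins G e x y" for e x y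
      using that by (cases e) auto
    have "ns ! m \<in> nodes G" if "m < length ns" for m
    proof (cases m)
      case 0
      then show ?thesis using edge[of "es ! 0"] less.prems by (auto simp: open_walk_def)
    next
      case (Suc m')
      then show ?thesis using edge[of "es ! m'"] less.prems that by (auto simp: open_walk_def)
    qed
    then have "set ns \<subseteq> nodes G" by (auto simp: in_set_conv_nth)
    then have "active_path G c ns es"
      using True less.prems unfolding active_path_def is_path_def open_walk_def collision_iff ancs_def
      by auto
    then show ?thesis by blast
  next
    case False
    then obtain i' j' where ij': "i' < j'" "j' < length (butlast (tl ns))"
      "butlast (tl ns) ! i' = butlast (tl ns) ! j'"
      by (auto simp: distinct_conv_nth) (metis linorder_neqE_nat)
    \<comment> \<open>\<open>butlast (tl ns)\<close> lists the inner nodes, so its positions are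
      shifted by one against \<open>ns\<close>.\<close>
    define i j where "i = Suc i'" and "j = Suc j'"
    have ij: "0 < i" "i < j" "j < length es" "ns ! i = ns ! j"
      using ij' len unfolding i_def j_def by (auto simp: nth_butlast nth_tl)
    let ?ns = "take i ns @ drop j ns" and ?es = "take i es @ drop j es"
    have "open_walk G c ?ns ?es" by (rule open_walk_shorten[OF G less.prems(1) ij])
    moreover have "?es \<noteq> []" "length ?es < length es" using ij by auto
    moreover have "hd ?ns = hd ns" "last ?ns = last ns" using ij len by (auto simp: hd_append)
    ultimately show ?thesis using less.hyps[of ?es ?ns] by metis
  qed
qed

text \<open>Disjointness from \<open>c\<close> admits the start as a noncollision node, and disjoint
  \<open>\<alpha>\<close> and \<open>\<beta>\<close> exclude the empty walk.\<close>

lemma implies_indep_iff_reach: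
  assumes G: "summary_graph u v G" and "\<alpha> \<inter> \<beta> = {}" "\<alpha> \<inter> c = {}"
  shows "implies_indep G \<alpha> \<beta> c \<longleftrightarrow>
    \<not> (\<exists>a\<in>\<alpha>. \<exists>x\<in>\<beta>. \<exists>b. reach (edge_rel G) (ancs G c) c a x b)"
proof -
  have "\<exists>b. reach (edge_rel G) (ancs G c) c (hd ns) (last ns) b"
    if "active_path G c ns es" "hd ns \<in> \<alpha>" for ns es
  proof -
    have w: "open_walk G c ns es" using that by (simp add: active_path_open_walk)
    then have "last ns = ns ! length es"
      by (metis diff_Suc_1 last_conv_nth length_0_conv nat.simps(3) open_walk_def)
    then show ?thesis using open_walk_reach[OF w, of "length es"] that assms by auto
  qed
  moreover have "\<exists>ns es. active_path G c ns es \<and> hd ns = a \<and> last ns = x"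
    if r: "reach (edge_rel G) (ancs G c) c a x b" and ne: "a \<noteq> x" for a x b
  proof -
    obtain ns es where w: "open_walk G c ns es" "hd ns = a" "last ns = x"
      using reach_open_walk[OF r] by blast
    then have "es \<noteq> []" using ne
      by (cases ns) (auto simp: open_walk_def)
    then show ?thesis using open_walk_active_path[OF G w(1)] w by auto
  qed
  ultimately show ?thesis
    using assms(2) unfolding implies_indep_def by (metis disjoint_iff)
qed

text \<open>
  A collision node outside \<open>Z\<close> with a descendant in \<open>Z\<close> can be replaced by a detour down to \<open>Z\<close>
  and back.
\<close>

lemma reach_detour:
  assumes "(w, x) \<in> (arrows G)\<^sup>*" "w \<in> Z" "x \<notin> Z" "reach (edge_rel G) Z Z a x b"
  shows "reach (edge_rel G) Z Z a x False"
  using assms(1,3,4)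
proof (induction arbitrary: b rule: rtrancl_induct)
  case base
  then show ?case using assms by simp
next
  case (step y z)
  have y: "reach (edge_rel G) Z Z a y True"
    by (rule reach.step[OF step.prems(2), of False]) (use step in auto)
  show ?case
  proof (cases "y \<in> Z")
    case True
    show ?thesis by (rule reach.step[OF y, of True]) (use step True in auto)
  next
    case False
    \<comment> \<open>The deeper detour comes back to \<open>y\<close> without arrowhead, so the
      return to \<open>z\<close> passes \<open>y\<close> as a noncollision node.\<close>
    show ?thesis by (rule reach.step[OF step.IH[OF False y], of True]) (use step False in auto)
  qed
qed

text \<open>This frees the collision condition from ancestors, so that graphs with different arrows
  can be compared step by step.\<close>

lemma reach_ancs_iff: "reach (edge_rel G) (ancs G Z) Z a x b \<longleftrightarrow> reach (edge_rel G) Z Z a x b"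
proof
  assume "reach (edge_rel G) (ancs G Z) Z a x b"
  then show "reach (edge_rel G) Z Z a x b"
  proof induction
    case (step x b b1 y b2)
    show ?case
    proof (cases "b \<and> b1 \<and> x \<notin> Z")
      case True
      then obtain w where w: "w \<in> Z" "(w, x) \<in> (arrows G)\<^sup>*"
        using step.hyps(3) by (auto simp: ancs_def is_ancestor_def intro: trancl_into_rtrancl)
      show ?thesis
        by (rule reach.step[OF reach_detour[OF w(2,1) _ step.IH] step.hyps(2)]) (use True in auto)
    next
      case False
      then show ?thesis using step.hyps(3) by (intro reach.step[OF step.IH step.hyps(2)]) auto
    qed
  qed (rule reach.start)
next
  assume "reach (edge_rel G) Z Z a x b"
  then show "reach (edge_rel G) (ancs G Z) Z a x b"
  proof induction
    case (step x b b1 y b2)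
    then show ?case by (intro reach.step[OF step.IH step.hyps(2)]) (auto simp: ancs_def)
  qed (rule reach.start)
qed

section \<open>Segments through marginalised nodes, and loops\<close>

inductive seg :: "('a \<Rightarrow> bool \<Rightarrow> 'a \<Rightarrow> bool \<Rightarrow> bool) \<Rightarrow> 'a set \<Rightarrow> 'a \<Rightarrow> bool \<Rightarrow> 'a \<Rightarrow> bool \<Rightarrow> bool"
  for E M x b where
  edge: "E x b y b' \<Longrightarrow> seg E M x b y b'"
| extend: "seg E M x b y b' \<Longrightarrow> y \<in> M \<Longrightarrow> E y b1 z b2 \<Longrightarrow> \<not> (b' \<and> b1) \<Longrightarrow> seg E M x b z b2"

lemma seg_trans:
  assumes "seg E M y b1 z b2" "seg E M x b y b'" "y \<in> M" "\<not> (b' \<and> b1)"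
  shows "seg E M x b z b2"
  using assms by induction (auto intro: seg.intros)

definition marginal :: "('a \<Rightarrow> bool \<Rightarrow> 'a \<Rightarrow> bool \<Rightarrow> bool) \<Rightarrow> 'a set \<Rightarrow> 'a \<Rightarrow> bool \<Rightarrow> 'a \<Rightarrow> bool \<Rightarrow> bool"
  where "marginal E M x b y b' \<longleftrightarrow> x \<notin> M \<and> y \<notin> M \<and> seg E M x b y b'"

lemma reach_seg:
  assumes "M \<inter> Z = {}" "reach E Z Z a x b" "seg E M x b1 y b2"
    "if b \<and> b1 then x \<in> Z else x \<notin> Z"
  shows "reach E Z Z a y b2"
  using assms(3)
proof induction
  case (edge y b')
  then show ?case using reach.step assms by metis
next
  case (extend y b' b1 z b2)
  then show ?case using assms(1) by (intro reach.step[OF extend.IH extend.hyps(3)]) auto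
qed

lemma reach_marginal_iff:
  assumes "M \<inter> Z = {}" "a \<notin> M" "x \<notin> M"
  shows "reach (marginal E M) Z Z a x b \<longleftrightarrow> reach E Z Z a x b"
proof
  assume "reach (marginal E M) Z Z a x b"
  then show "reach E Z Z a x b"
  proof induction
    case (step x b b1 y b2)
    then show ?case using reach_seg[OF assms(1) step.IH] by (auto simp: marginal_def)
  qed (rule reach.start)
next
  let ?R = "reach (marginal E M) Z Z a"
  assume "reach E Z Z a x b"
  \<comment> \<open>Inside \<open>M\<close> the invariant keeps the last node \<open>w\<close>
    outside \<open>M\<close> and the unfinished segment from it; the condition at \<open>w\<close>
    already refers to the first flag \<open>b0\<close> of that segment.\<close>
  then have "if x \<notin> M then ?R x b else \<exists>w m b0. ?R w m \<and> w \<notin> M \<and>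
    (if m \<and> b0 then w \<in> Z else w \<notin> Z) \<and> seg E M w b0 x b"
  proof induction
    case start
    then show ?case using assms by (simp add: reach.start)
  next
    case (step x b b1 y b2)
    have "\<exists>w m b0. ?R w m \<and> w \<notin> M \<and> (if m \<and> b0 then w \<in> Z else w \<notin> Z) \<and> seg E M w b0 y b2"
    proof (cases "x \<in> M")
      case True
      then have "\<not> (b \<and> b1)" using step.hyps(3) assms(1) by (auto split: if_splits)
      then show ?thesis using step.IH step.hyps(2) True
        by (simp split del: if_split) (blast intro: seg.extend)
    next
      case False
      then show ?thesis using step.IH step.hyps(2,3) by (metis seg.edge)
    qed
    then obtain w m b0 where w: "?R w m" "w \<notin> M" "if m \<and> b0 then w \<in> Z else w \<notin> Z"
      "seg E M w b0 y b2" by blast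
    show ?case
    proof (cases "y \<in> M")
      case True
      then have "\<not> y \<notin> M" by simp
      then show ?thesis unfolding if_not_P[OF \<open>\<not> y \<notin> M\<close>] using w by blast
    next
      case False
      then have "marginal E M w b0 y b2" using w by (simp add: marginal_def)
      then show ?thesis using False reach.step[OF w(1) _ w(3)] by simp
    qed
  qed
  then show "?R x b" using assms by simp
qed

text \<open>
  A loop with arrowheads at both ends only serves to turn a state without arrowhead into one with
  arrowhead, which allows nothing more outside \<open>Z\<close>. A loop without arrowheads, in contrast, could
  turn a collision node into a noncollision node.
\<close>

lemma reach_loopless:
  assumes loops: "\<And>x b w b1 b2. E x False x b \<Longrightarrow> \<not> E w b1 x True"
    "\<And>x. \<not> E x True x False"
    and "reach E Z Z a x b"
  shows "\<exists>b'. reach (\<lambda>x b y b'. x \<noteq> y \<and> E x b y b') Z Z a x b'"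
proof -
  let ?R = "reach (\<lambda>x b y b'. x \<noteq> y \<and> E x b y b') Z Z a"
  \<comment> \<open>Skipping a loop may lose an arrowhead at \<open>x\<close>, but only outside
    \<open>Z\<close>, where the state without arrowhead can go on in every way. The first conjunct
    makes the first assumption on loops applicable: a loop left without arrowhead then changes no
    state.\<close>
  have "(b \<longrightarrow> (\<exists>w b1. E w b1 x True)) \<and> (?R x b \<or> x \<notin> Z \<and> ?R x False)"
    using assms(3)
  proof induction
    case start
    then show ?case by (simp add: reach.start)
  next
    case (step x b b1 y b2)
    have b2: "b2 \<longrightarrow> (\<exists>w b1. E w b1 y True)" using step.hyps(2) by (cases b2) auto
    show ?case
    proof (cases "x = y")
      case False
      then have "?R y b2"
      proof (cases "?R x b")
        case True
        then show ?thesis by (rule reach.step[of _ _ _ _ _ _ b1]) (use False step in auto)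
      next
        case False
        then have "x \<notin> Z" "?R x False" using step.IH by auto
        from this(2) show ?thesis
          by (rule reach.step[of _ _ _ _ _ _ b1]) (use \<open>x \<noteq> y\<close> \<open>x \<notin> Z\<close> step.hyps in auto)
      qed
      then show ?thesis using b2 by blast
    next
      case True
      show ?thesis
      proof (cases b1)
        case True
        then have "b2" using step.hyps(2) loops(2)[of x] \<open>x = y\<close> by (cases b2) auto
        then show ?thesis using step b2 True \<open>x = y\<close> by (cases b) auto
      next
        case False
        then have loop: "E x False x b2" using step.hyps(2) \<open>x = y\<close> by simp
        have "\<not> b2" using loops(1)[OF loop, of x False] loop by (cases b2) auto
        moreover have "\<not> b" using step.IH loops(1)[OF loop] by blast
        ultimately show ?thesis using step \<open>x = y\<close> by auto
      qed
    qed
  qed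
  then show ?thesis by blast
qed

section \<open>Conditioning\<close>

locale conditioned_dag =
  fixes G :: "'a mixed_graph" and V C :: "'a set"
  assumes arrows: "arrows G \<subseteq> V \<times> V" and acyclic: "acyclic (arrows G)"
    and dashed: "dashed G = {}" and full: "full G = {}" and C: "C \<subseteq> V"
begin

definition F where "F = {k \<in> V - C. \<exists>i\<in>C. is_ancestor G k i}"

definition R where "R = C \<union> F"

definition Oc where "Oc = V - R"

definition r where "r = {(i, k) \<in> arrows G. i \<in> Oc \<and> k \<notin> C}"

text \<open>The reflexive closure admits \<open>j = i\<close> and \<open>j = k\<close>, so adjacency
  and a common child in \<open>R\<close> are covered together. This is the off-diagonal pattern of
  \<open>S\<close>.\<close>

definition s where
  "s = {(i, k). i \<in> F \<and> k \<in> F \<and> i \<noteq> k \<and> (\<exists>j\<in>R. (j, i) \<in> (arrows G)\<^sup>= \<and> (j, k) \<in> (arrows G)\<^sup>=)}"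

text \<open>The summary graph for an empty marginalising set.\<close>

definition G1 :: "'a mixed_graph" where
  "G1 = \<lparr>nodes = V - C, arrows = r, dashed = {}, full = s\<rparr>"

lemma G1_simps [simp]: "arrows G1 = r" "dashed G1 = {}" "full G1 = s"
  by (simp_all add: G1_def)

text \<open>Closure of \<open>R\<close> under parents: all edges between \<open>R\<close> and
  \<open>Oc\<close> are arrows pointing into \<open>Oc\<close>.\<close>

lemma R_ancestral: "(x, y) \<in> arrows G \<Longrightarrow> x \<in> R \<Longrightarrow> y \<in> R"
  using arrows unfolding R_def F_def is_ancestor_def
  by (blast intro: trancl_into_trancl)

lemma R_subset_ancs: "C \<subseteq> Z \<Longrightarrow> R \<subseteq> ancs G Z"
  unfolding R_def F_def ancs_def by auto

lemma sets: "F \<inter> Oc = {}" "F \<inter> C = {}" "Oc \<inter> C = {}" "R \<inter> Oc = {}" "V = Oc \<union> F \<union> C"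
  using C by (auto simp: Oc_def R_def F_def)

lemma s_sym: "(i, k) \<in> s \<Longrightarrow> (k, i) \<in> s"
  by (auto simp: s_def)

lemma r_subset: "r \<subseteq> Oc \<times> (Oc \<union> F)"
  using arrows sets by (auto simp: r_def)

lemma s_subset: "s \<subseteq> F \<times> F"
  by (auto simp: s_def)

text \<open>
  A node of \<open>F\<close> outside \<open>Z\<close> has a descendant in \<open>C \<subseteq> Z\<close>, so that it never blocks a walk.
\<close>

lemma reach_G1_reach_G:
  assumes "C \<subseteq> Z" "a \<notin> Z" and "reach (edge_rel G1) Z Z a x b"
  shows "\<exists>b. reach (edge_rel G) Z Z a x b"
proof -
  let ?L = "reach (edge_rel G) (ancs G Z) Z a"
  have RZ: "R \<subseteq> ancs G Z" by (rule R_subset_ancs[OF assms(1)])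
  have Z: "Z \<subseteq> ancs G Z" by (auto simp: ancs_def)
  \<comment> \<open>Such a node satisfies the collision and the noncollision condition, so the flags
    \<open>b'\<close> and \<open>b1\<close> are irrelevant.\<close>
  have passF: "?L y b2" if "x \<in> F" "x \<notin> Z" "?L x b'" "edge_rel G x b1 y b2" for x y b' b1 b2
    by (rule reach.step[OF that(3,4)]) (use that RZ in \<open>auto simp: R_def\<close>)
  have "(x \<in> F \<longrightarrow> \<not> b) \<and> (if x \<in> F then \<exists>b'. ?L x b' else ?L x b)"
    using assms(3)
  proof induction
    case start
    then show ?case by (auto intro: reach.start)
  next
    case (step x b b1 y b2)
    have xZ: "x \<notin> Z" if "x \<in> F" using step that by (auto split: if_splits)
    have pass: "?L y' b2'" if "edge_rel G x b1 y' b2'" for y' b2'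
    proof (cases "x \<in> F")
      case True
      then show ?thesis using passF xZ step.IH that by auto
    next
      case False
      then have "?L x b" using step.IH by auto
      from reach.step[OF this that] show ?thesis using step.hyps(3) Z by (auto split: if_splits)
    qed
    consider "\<not> b1" "b2" "(y, x) \<in> r" | "b1" "\<not> b2" "(x, y) \<in> r" | "\<not> b1" "\<not> b2" "(x, y) \<in> s"
      using step.hyps(2) by (cases b1; cases b2) auto
    then show ?case
    proof cases
      case 1
      then have "?L y True" using pass[of y True] by (auto simp: r_def)
      then show ?thesis using 1 r_subset sets by auto
    next
      case 2
      then have "?L y False" using pass[of y False] by (auto simp: r_def)
      then show ?thesis using 2 by auto
    next
      case 3
      \<comment> \<open>A full line unfolds to an edge inside \<open>F\<close> or to two edges
        meeting in the collision node \<open>j\<close>, which is open since \<open>R\<close> lies in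
        \<open>ancs G Z\<close>.\<close>
      then obtain j where j: "j \<in> R" "j = x \<or> (j, x) \<in> arrows G" "j = y \<or> (j, y) \<in> arrows G"
        and xy: "x \<in> F" "y \<in> F" "x \<noteq> y" by (auto simp: s_def)
      obtain b' where L: "?L x b'" using step.IH xy by auto
      have "\<exists>b'. ?L y b'"
      proof (cases "j = x")
        case True
        then have "edge_rel G x True y False" using j xy by auto
        then show ?thesis using passF[OF xy(1) xZ[OF xy(1)] L] by blast
      next
        case False
        then have Lj: "?L j True" using passF[OF xy(1) xZ[OF xy(1)] L, of False] j by auto
        show ?thesis
        proof (cases "j = y")
          case False
          then have "edge_rel G j True y False" using j by auto
          from reach.step[OF Lj this] show ?thesis using j RZ by auto
        qed (use Lj in auto)
      qed
      then show ?thesis using 3 xy by auto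
    qed
  qed
  then have "\<exists>b. ?L x b" by (auto split: if_splits)
  then show ?thesis by (simp add: reach_ancs_iff)
qed

text \<open>
  The nodes of \<open>C\<close> and the conditioned nodes of \<open>F\<close> can only be passed as collision nodes
  \<open>w \<rightarrow> x \<leftarrow> y\<close>, in which case \<open>w\<close> and \<open>y\<close> are joined by a full line; so for these it
  suffices to remember \<open>w\<close>.
\<close>

lemma reach_G_reach_G1:
  assumes "C \<subseteq> Z" "a \<in> V" "a \<notin> Z" and "reach (edge_rel G) Z Z a x b" "x \<notin> Z"
  shows "\<exists>b. reach (edge_rel G1) Z Z a x b"
proof -
  let ?S = "reach (edge_rel G1) Z Z a"
  have full_step: "?S y False"
    if "?S w False" "w \<in> F - Z" "y \<in> F - Z" "j \<in> R" "(j, w) \<in> (arrows G)\<^sup>=" "(j, y) \<in> (arrows G)\<^sup>="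
    for w y j
  proof (cases "w = y")
    case False
    then have "edge_rel G1 w False y False" using that by (auto simp: s_def)
    from reach.step[OF that(1) this] show ?thesis using that by simp
  qed (use that in auto)
  \<comment> \<open>In \<open>G1\<close> no edge has an arrowhead at a node of \<open>F\<close>, so
    the flag is kept only on \<open>Oc\<close>.\<close>
  have "x \<in> V \<and> (x \<in> Oc \<longrightarrow> ?S x b) \<and> (x \<in> F - Z \<longrightarrow> ?S x False) \<and>
      (x \<in> R \<inter> Z \<and> b \<longrightarrow> (\<exists>w\<in>F - Z. ?S w False \<and> (x, w) \<in> arrows G))"
    using assms(4)
  proof induction
    case start
    then show ?case using assms by (auto intro: reach.start)
  next
    case (step x b b1 y b2)
    consider "\<not> b1" "b2" "(y, x) \<in> arrows G" | "b1" "\<not> b2" "(x, y) \<in> arrows G"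
      using step.hyps(2) dashed full by (cases b1; cases b2) auto
    then show ?case
    proof cases
      case 1
      have xZ: "x \<notin> Z" using step.hyps(3) 1 by simp
      have y: "y \<in> V" using 1 arrows by auto
      have S: "?S x b \<or> ?S x False" using step.IH xZ sets assms(1) by auto
      have O: "?S y True" if "y \<in> Oc"
      proof -
        have "edge_rel G1 x False y True" using 1 that xZ assms(1) by (auto simp: r_def)
        then show ?thesis using S reach.step[of "edge_rel G1" Z Z a x _ False y True] xZ by auto
      qed
      \<comment> \<open>\<open>R\<close> is closed under parents and \<open>C\<close> lies in
        \<open>Z\<close>, so \<open>x\<close> is itself the parent to remember.\<close>
      have xF: "x \<in> F - Z \<and> ?S x False" if "y \<in> R"
        using R_ancestral[OF 1(3) that] xZ assms(1) step.IH by (auto simp: R_def)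
      have F: "?S y False" if "y \<in> F - Z"
        using full_step[of x y y] xF that 1 by (auto simp: R_def)
      from 1(2) have "b2 = True" by simp
      then show ?thesis using y O F xF 1(3) by blast
    next
      case 2
      have y: "y \<in> V" using 2 arrows by auto
      have sub: "?S y False" if "x \<in> Oc" "y \<notin> C"
      proof -
        have "edge_rel G1 x True y False" using 2 that by (auto simp: r_def)
        then show ?thesis
          using step.IH that step.hyps(3) 2 reach.step[of "edge_rel G1" Z Z a x b True y False] by auto
      qed
      have F: "?S y False" if "y \<in> F - Z"
      proof (cases "x \<in> Oc")
        case True
        then show ?thesis using sub that sets by auto
      next
        case False
        then have xR: "x \<in> R" using step.IH by (auto simp: Oc_def)
        show ?thesis
        proof (cases "x \<in> Z")
          case True
          then have b using step.hyps(3) by (auto split: if_splits)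
          \<comment> \<open>The remembered parent \<open>w\<close> has the child \<open>x\<close> in
            common with \<open>y\<close>, which yields a full line unless
            \<open>w = y\<close>.\<close>
          then obtain w where "w \<in> F - Z" "?S w False" "(x, w) \<in> arrows G"
            using step.IH True xR by auto
          then show ?thesis using full_step[of w y x] xR 2 that by auto
        next
          case False
          then have "x \<in> F - Z" using xR assms(1) by (auto simp: R_def)
          then show ?thesis using full_step[of x y x] xR 2 that step.IH by auto
        qed
      qed
      have O: "?S y False" if "y \<in> Oc"
      proof -
        have "x \<in> Oc"
          using R_ancestral[OF 2(3)] that step.IH sets by (auto simp: Oc_def)
        then show ?thesis using sub that sets by auto
      qed
      show ?thesis using y O F 2 by auto
    qed
  qed
  then show ?thesis using assms(1,5) sets by (auto simp: R_def)
qed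

lemma reach_G1_iff:
  assumes "C \<subseteq> Z" "a \<in> V" "a \<notin> Z" "x \<notin> Z"
  shows "(\<exists>b. reach (edge_rel G1) Z Z a x b) \<longleftrightarrow> (\<exists>b. reach (edge_rel G) Z Z a x b)"
  using reach_G1_reach_G reach_G_reach_G1 assms by metis

text \<open>Inner nodes lie in \<open>Oc\<close>, so every step has its head in \<open>Oc\<close>
  and its tail outside \<open>C\<close>, as \<open>r\<close> demands.\<close>

lemma via_r_iff:
  assumes "p \<subseteq> Oc" "i \<in> Oc" "k \<notin> C"
  shows "via p r i k \<longleftrightarrow> via p (arrows G) i k"
proof
  assume "via p r i k"
  then show "via p (arrows G) i k" by (rule via_mono) (auto simp: r_def)
next
  assume "via p (arrows G) i k"
  then show "via p r i k"
    using assms(2,3)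
  proof induction
    case (edge i k)
    then show ?case by (auto simp: r_def intro: via.edge)
  next
    case (extend i j k)
    then have "j \<in> Oc" "j \<notin> C" using assms(1) sets by auto
    then show ?case using extend by (auto simp: r_def intro: via.extend)
  qed
qed

end

section \<open>Marginalising\<close>

locale summarised_dag = conditioned_dag +
  fixes M :: "'a set"
  assumes M: "M \<subseteq> V - C"
begin

definition u where "u = Oc - M"
definition v where "v = F - M"
definition p where "p = Oc \<inter> M"
definition q where "q = F \<inter> M"

lemma parts: "p \<subseteq> M" "q \<subseteq> M" "M = p \<union> q" "p \<subseteq> Oc" "q \<subseteq> F" "u \<subseteq> Oc" "v \<subseteq> F"
  "u \<inter> v = {}" "u \<union> v = V - (C \<union> M)" "u \<inter> M = {}" "v \<inter> M = {}"
  unfolding u_def v_def p_def q_def using M sets by blast+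

text \<open>The pattern of the product \<open>D_uq P\<close>: from \<open>i\<close> against arrows
  through \<open>p\<close> to a node of \<open>q\<close>, then along full lines.\<close>

definition to_F where "to_F i k \<longleftrightarrow> k \<in> F \<and> (\<exists>j\<in>q. via p r i j \<and> via q s j k)"

text \<open>The two products in \<open>Wuu\<close>: a common source in \<open>p\<close>, or sources
  in \<open>q\<close> that coincide or are linked by full lines.\<close>

definition cov where
  "cov i k \<longleftrightarrow> (\<exists>j\<in>p. via p r i j \<and> via p r k j) \<or>
     (\<exists>j\<in>q. \<exists>j'\<in>q. via p r i j \<and> (j = j' \<or> via q s j j') \<and> via p r k j')"

definition H :: "'a mixed_graph" where
  "H = \<lparr> nodes = u \<union> v,
     arrows = {(i, k). i \<in> u \<and> k \<in> u \<union> v \<and> i \<noteq> k \<and> (via p r i k \<or> to_F i k)},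
     dashed = {(i, k). i \<in> u \<and> k \<in> u \<and> i \<noteq> k \<and> cov i k},
     full = {(i, k). i \<in> v \<and> k \<in> v \<and> i \<noteq> k \<and> via q s i k} \<rparr>"

lemma via_s_in: "via q s i k \<Longrightarrow> i \<in> F \<and> k \<in> F"
  by (induction rule: via.induct) (use s_subset in auto)

lemma via_s_sym: "via q s i k \<longleftrightarrow> via q s k i"
proof -
  have "s\<inverse> = s" using s_sym by auto
  then show ?thesis using via_converse[of q s] by metis
qed

lemma cov_sym: "cov i k \<longleftrightarrow> cov k i"
  unfolding cov_def using via_s_sym by blast

lemma seg_r:
  assumes "via p r i k"
  shows "seg (edge_rel G1) M k False i True" "seg (edge_rel G1) M i True k False"
  using assms
proof induction
  case (edge i k)
  { case 1 show ?case using edge by (auto intro: seg.edge) }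
  { case 2 show ?case using edge by (auto intro: seg.edge) }
next
  case (extend i j k)
  have j: "j \<in> M" using extend parts by auto
  { case 1
    show ?case by (rule seg_trans[OF extend.IH(1) seg.edge j, of _ _ True]) (use extend in auto) }
  { case 2
    show ?case by (rule seg.extend[OF extend.IH(2) j, of True]) (use extend in auto) }
qed

lemma seg_s: "via q s i k \<Longrightarrow> seg (edge_rel G1) M i False k False"
proof (induction rule: via.induct)
  case (edge i k)
  then show ?case by (auto intro: seg.edge)
next
  case (extend i j k)
  then have "j \<in> M" using parts by auto
  then show ?case by (rule seg.extend[OF extend.IH, of False]) (use extend in auto)
qed

text \<open>Without collisions, and with full lines only in \<open>F\<close>, where no arrowheads
  occur, a segment first runs against arrows, then along full lines, then along arrows, each stretch
  possibly empty. The end flags tell which of the arrow stretches are present.\<close>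

lemma seg_cases:
  assumes "seg (edge_rel G1) M x b y b'"
  shows "if b then x \<in> Oc \<and> (if b' then y \<in> Oc \<and> cov x y else via p r x y \<or> to_F x y)
         else if b' then y \<in> Oc \<and> (via p r y x \<or> to_F y x) else via q s x y"
  using assms
proof induction
  case (edge y b')
  then show ?case using r_subset by (cases b; cases b') (auto intro: via.edge)
next
  case (extend y b' b1 z b2)
  have M': "y \<in> Oc \<Longrightarrow> y \<in> p" "y \<in> F \<Longrightarrow> y \<in> q" using extend.hyps by (auto simp: p_def q_def)
  consider "\<not> b1" "b2" "(z, y) \<in> r" | "b1" "\<not> b2" "(y, z) \<in> r" | "\<not> b1" "\<not> b2" "(y, z) \<in> s"
    using extend.hyps by (cases b1; cases b2) auto
  then show ?case
  proof cases
    case 1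
    then have z: "z \<in> Oc" "via p r z y" using r_subset by (auto intro: via.edge)
    have y: "y \<in> Oc \<or> y \<in> F" using 1 r_subset by auto
    show ?thesis
    proof (cases b)
      case True
      have "cov x z"
      proof (cases b')
        case True
        then have "y \<in> p" "cov x y" using extend.IH \<open>b\<close> M' by auto
        then show ?thesis using z(2) via_trans[of p r y _ z] unfolding cov_def by blast
      next
        case False
        then have "via p r x y \<or> to_F x y" using extend.IH \<open>b\<close> by auto
        then show ?thesis using z(2) y M' unfolding cov_def to_F_def by blast
      qed
      then show ?thesis using True 1 z extend.IH by auto
    next
      case False
      have "via p r z x \<or> to_F z x"
      proof (cases b')
        case True
        then have "y \<in> p" "via p r y x \<or> to_F y x" using extend.IH False M' by auto
        then show ?thesis using z(2) via_trans[of p r y _ z] unfolding to_F_def by blast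
      next
        case b': False
        then have s: "via q s x y" using extend.IH False by auto
        then have "y \<in> q" "x \<in> F" using via_s_in M' by auto
        then show ?thesis using s z(2) via_s_sym unfolding to_F_def by blast
      qed
      then show ?thesis using False 1 z by auto
    qed
  next
    case 2
    \<comment> \<open>Going on against an arrow requires that \<open>y\<close> was entered neither
      with an arrowhead nor by a full line, so the segment so far only ran against arrows.\<close>
    then have y: "y \<in> Oc" "y \<notin> F" "\<not> b'" using r_subset extend.hyps sets by auto
    then have "b" "via p r x y" "x \<in> Oc" using extend.IH via_s_in[of x y]
      by (auto simp: to_F_def split: if_splits)
    then show ?thesis using 2 y M' by (auto intro: via.extend)
  next
    case 3
    then have y: "y \<in> q" "y \<notin> Oc" "z \<in> F" using s_subset M' sets by auto
    then have "\<not> b'" using extend.IH by (auto split: if_splits)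
    show ?thesis
    proof (cases b)
      case True
      then have "via p r x y \<or> to_F x y" "x \<in> Oc" using extend.IH \<open>\<not> b'\<close> by auto
      then have "to_F x z" using y 3(3) via.edge[OF 3(3), of q] via.extend[OF _ y(1) 3(3)]
        unfolding to_F_def by blast
      then show ?thesis using True \<open>x \<in> Oc\<close> 3 by auto
    next
      case False
      then show ?thesis using extend.IH \<open>\<not> b'\<close> y 3 by (auto intro: via.extend)
    qed
  qed
qed

lemma seg_to_F:
  assumes "to_F i k"
  shows "seg (edge_rel G1) M k False i True" "seg (edge_rel G1) M i True k False"
proof -
  obtain j where j: "j \<in> M" "via p r i j" "via q s j k"
    using assms parts by (auto simp: to_F_def)
  show "seg (edge_rel G1) M k False i True"
    by (rule seg_trans[OF seg_r(1)[OF j(2)] seg_s j(1)]) (use j via_s_sym in auto)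
  show "seg (edge_rel G1) M i True k False"
    by (rule seg_trans[OF seg_s[OF j(3)] seg_r(2)[OF j(2)] j(1)]) auto
qed

lemma seg_cov:
  assumes "cov i k"
  shows "seg (edge_rel G1) M i True k True"
  using assms unfolding cov_def
proof (elim disjE bexE conjE)
  fix j assume "j \<in> p" "via p r i j" "via p r k j"
  then show ?thesis using seg_trans[OF seg_r(1)[of k j] seg_r(2)[of i j]] parts by auto
next
  fix j j' assume "j \<in> q" "j' \<in> q" "via p r i j" "via p r k j'" "j = j'"
  then show ?thesis using seg_trans[OF seg_r(1)[of k j] seg_r(2)[of i j]] parts by auto
next
  fix j j' assume j: "j \<in> q" "j' \<in> q" "via p r i j" "via p r k j'" "via q s j j'"
  then have "to_F i j'" using via_s_in by (auto simp: to_F_def)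
  then show ?thesis using seg_trans[OF seg_r(1)[of k j'] seg_to_F(2)[of i j']] j parts by auto
qed

lemma seg_nodes:
  assumes "seg (edge_rel G1) M x b y b'"
  shows "x \<in> Oc \<union> F" "y \<in> Oc \<union> F"
proof -
  have nodes: "w \<in> Oc \<union> F \<and> z \<in> Oc \<union> F" if "edge_rel G1 w b z b'" for w b z b'
    using that r_subset s_subset by (cases b; cases b') auto
  have "x \<in> Oc \<union> F \<and> y \<in> Oc \<union> F"
    using assms by induction (use nodes in blast)+
  then show "x \<in> Oc \<union> F" "y \<in> Oc \<union> F" by auto
qed

lemma edge_rel_H: "edge_rel H = (\<lambda>x b y b'. x \<noteq> y \<and> marginal (edge_rel G1) M x b y b')"
proof (intro ext)
  fix x b y b'
  show "edge_rel H x b y b' \<longleftrightarrow> x \<noteq> y \<and> marginal (edge_rel G1) M x b y b'"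
  proof
    assume "edge_rel H x b y b'"
    then show "x \<noteq> y \<and> marginal (edge_rel G1) M x b y b'"
      using parts seg_r seg_s seg_to_F seg_cov unfolding marginal_def
      by (cases b; cases b') (auto simp: H_def)
  next
    assume "x \<noteq> y \<and> marginal (edge_rel G1) M x b y b'"
    then have m: "x \<noteq> y" "x \<notin> M" "y \<notin> M" "seg (edge_rel G1) M x b y b'"
      by (auto simp: marginal_def)
    have "x \<in> u \<union> v" "y \<in> u \<union> v" "x \<in> Oc \<Longrightarrow> x \<in> u" "y \<in> Oc \<Longrightarrow> y \<in> u" "x \<in> F \<Longrightarrow> x \<in> v" "y \<in> F \<Longrightarrow> y \<in> v"
      using m(2,3) seg_nodes[OF m(4)] by (auto simp: u_def v_def)
    then show "edge_rel H x b y b'"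
      using m(1) seg_cases[OF m(4)] via_s_in[of x y]
      by (cases b; cases b') (auto simp: H_def)
  qed
qed

lemma no_via_loop: "\<not> via p r i i"
proof
  assume "via p r i i"
  then have "via p (arrows G) i i" by (rule via_mono) (auto simp: r_def)
  then show False using acyclic via_in_trancl by (fastforce simp: acyclic_def)
qed

text \<open>\<open>H\<close> is the marginal graph without its loops. A loop leaving
  \<open>x\<close> without arrowhead exists only for \<open>x\<close> in \<open>F\<close>, where no
  arrowhead ever ends, and a loop with exactly one arrowhead would be a directed cycle; so
  \<open>reach_loopless\<close> applies.\<close>

lemma reach_H_iff:
  assumes "M \<inter> Z = {}" "a \<notin> M" "x \<notin> M"
  shows "(\<exists>b. reach (edge_rel H) Z Z a x b) \<longleftrightarrow> (\<exists>b. reach (edge_rel G1) Z Z a x b)"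
proof -
  let ?E = "marginal (edge_rel G1) M"
  have mono: "reach ?E Z Z a x b" if "reach (edge_rel H) Z Z a x b" for b
    using that by induction (auto simp: edge_rel_H intro: reach.intros)
  have loop: "x \<in> F \<and> \<not> b" if "?E x False x b" for x b
    using seg_cases[of x False x b] that no_via_loop[of x] via_s_in[of x x] sets
    by (auto simp: marginal_def to_F_def split: if_splits)
  have head: "x \<in> Oc" if "?E w b x True" for w b x
    using seg_cases[of w b x True] that by (auto simp: marginal_def split: if_splits)
  have "\<exists>b'. reach (edge_rel H) Z Z a x b'" if "reach ?E Z Z a x b" for b
    unfolding edge_rel_H
  proof (rule reach_loopless[OF _ _ that])
    show "\<not> ?E w b1 x True" if "?E x False x b" for x b w b1
      using loop[OF that] head[of w b1 x] sets by auto
    show "\<not> ?E x True x False" for x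
      using seg_cases[of x True x False] no_via_loop[of x] sets
      by (auto simp: marginal_def to_F_def)
  qed
  then show ?thesis using mono reach_marginal_iff[OF assms, of "edge_rel G1"] by blast
qed

lemma summary_graph_H:
  assumes "finite V"
  shows "summary_graph u v H"
proof -
  have "acyclic (arrows H \<inter> u \<times> u)"
  \<comment> \<open>The double converse is just the transitive closure of the arrows of
    \<open>G\<close>.\<close>
  proof (rule acyclic_subset[OF acyclic_converse[THEN iffD2, OF acyclic_converse[THEN iffD2]]])
    show "acyclic ((arrows G)\<^sup>+)" using acyclic by (simp add: acyclic_def)
    show "arrows H \<inter> u \<times> u \<subseteq> (((arrows G)\<^sup>+)\<inverse>)\<inverse>"
    proof
      fix e assume "e \<in> arrows H \<inter> u \<times> u"
      then obtain i k where e: "e = (i, k)" "via p r i k"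
        using parts sets by (auto simp: H_def to_F_def)
      then have "via p (arrows G) i k" using via_mono[of p r] by (auto simp: r_def)
      then show "e \<in> (((arrows G)\<^sup>+)\<inverse>)\<inverse>" using e via_in_trancl by auto
    qed
  qed
  moreover have "finite u" "finite v"
    using finite_subset[OF _ assms] by (auto simp: u_def v_def Oc_def F_def)
  ultimately show ?thesis
    using parts cov_sym via_s_sym
    by (auto simp: summary_graph_def H_def sym_def irrefl_def)
qed

text \<open>No edge of \<open>H\<close> starts in \<open>C\<close>, so adding \<open>C\<close> to
  the conditioning set changes no step.\<close>

lemma reach_H_cong:
  assumes "a \<in> u \<union> v"
  shows "reach (edge_rel H) (c \<union> C) (c \<union> C) a x b \<longleftrightarrow> reach (edge_rel H) c c a x b"
proof -
  have x: "x \<notin> C" if "edge_rel H x b y b'" for x b y b'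
    using that seg_nodes(1)[of x b y b'] sets by (auto simp: edge_rel_H marginal_def)
  show ?thesis
  proof
    assume "reach (edge_rel H) (c \<union> C) (c \<union> C) a x b"
    then show "reach (edge_rel H) c c a x b"
    proof induction
      case (step x b b1 y b2)
      show ?case by (rule reach.step[OF step.IH step.hyps(2)])
          (use step.hyps(3) x[OF step.hyps(2)] in \<open>auto split: if_splits\<close>)
    qed (rule reach.start)
  next
    assume "reach (edge_rel H) c c a x b"
    then show "reach (edge_rel H) (c \<union> C) (c \<union> C) a x b"
    proof induction
      case (step x b b1 y b2)
      show ?case by (rule reach.step[OF step.IH step.hyps(2)])
          (use step.hyps(3) x[OF step.hyps(2)] in \<open>auto split: if_splits\<close>)
    qed (rule reach.start)
  qed
qed

lemma implies_indep_H_iff: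
  assumes "finite V" "summary_graph V {} G"
    and "\<alpha> \<subseteq> u \<union> v" "\<beta> \<subseteq> u \<union> v" "c \<subseteq> u \<union> v"
    and "\<alpha> \<inter> \<beta> = {}" "\<alpha> \<inter> c = {}" "\<beta> \<inter> c = {}"
  shows "implies_indep H \<alpha> \<beta> c \<longleftrightarrow> implies_indep G \<alpha> \<beta> (c \<union> C)"
proof -
  have "(\<exists>b. reach (edge_rel H) (ancs H c) c a x b) \<longleftrightarrow>
      (\<exists>b. reach (edge_rel G) (ancs G (c \<union> C)) (c \<union> C) a x b)"
    if "a \<in> \<alpha>" "x \<in> \<beta>" for a x
  proof -
    let ?Z = "c \<union> C"
    have ax: "a \<in> V" "a \<notin> ?Z" "x \<notin> ?Z" "a \<notin> M" "x \<notin> M" "a \<in> u \<union> v" "M \<inter> ?Z = {}"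
      using that assms parts M by auto
    have "(\<exists>b. reach (edge_rel H) c c a x b) \<longleftrightarrow> (\<exists>b. reach (edge_rel H) ?Z ?Z a x b)"
      using reach_H_cong[OF ax(6)] by simp
    also have "\<dots> \<longleftrightarrow> (\<exists>b. reach (edge_rel G1) ?Z ?Z a x b)"
      by (rule reach_H_iff[OF ax(7,4,5)])
    also have "\<dots> \<longleftrightarrow> (\<exists>b. reach (edge_rel G) ?Z ?Z a x b)"
      by (rule reach_G1_iff[OF _ ax(1-3)]) simp
    finally show ?thesis by (simp add: reach_ancs_iff)
  qed
  moreover have "\<alpha> \<inter> (c \<union> C) = {}" using assms parts by auto
  ultimately show ?thesis
    using implies_indep_iff_reach[OF summary_graph_H[OF assms(1)] assms(6,7)]
      implies_indep_iff_reach[OF assms(2,6)] by metis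
qed

end

section \<open>The edge matrices\<close>

lemma sum_nonneg_nonzero_iff:
  fixes f :: "'a \<Rightarrow> real"
  assumes "finite A" "\<And>j. j \<in> A \<Longrightarrow> 0 \<le> f j"
  shows "sum f A \<noteq> 0 \<longleftrightarrow> (\<exists>j\<in>A. f j \<noteq> 0)"
  using sum_nonneg_eq_0_iff[of A f] assms by auto

context summarised_dag
begin

definition A where "A = edge_matrix G"
definition S where "S = sub (In (mmul R (mtransp (sub A R R)) (sub A R R))) F F"
definition D where "D = zer p (V - p) A"
definition Z where "Z = zer q v S"

context
  assumes fin: "finite V"
begin

lemma finite_parts: "finite p" "finite q" "finite R"
  using finite_subset[OF _ fin] parts(4,5) C by (auto simp: Oc_def F_def R_def)

lemma A_rel: "{(i, k). A i k \<noteq> 0} = (arrows G)\<^sup>="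
  by (auto simp: A_def edge_matrix_def)

text \<open>Compared with \<open>r\<close>, the matrix \<open>A\<close> also has loops and the
  remaining arrows of \<open>G\<close>. The loops only add the diagonal, and the other arrows are
  harmless by \<open>via_r_iff\<close>.\<close>

lemma D_eq:
  assumes "i \<in> u" "k \<in> u \<union> M \<union> F"
  shows "D i k = of_bool (i = k \<or> via p r i k)"
proof -
  have ik: "i \<in> Oc" "k \<notin> C" "i \<in> V" "k \<in> V" using assms parts sets M by auto
  have "D i k = of_bool (via p {(i, k). A i k \<noteq> 0} i k)"
    unfolding D_def
    by (rule zer_eq_via) (use finite_parts ik in \<open>auto simp: A_def edge_matrix_def\<close>)
  also have "via p {(i, k). A i k \<noteq> 0} i k \<longleftrightarrow> i = k \<or> via p (arrows G) i k"
  proof (cases "i = k")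
    case True
    then have "(i, k) \<in> (arrows G)\<^sup>=" by simp
    then show ?thesis unfolding A_rel using True by (simp add: via.edge)
  next
    case False
    then show ?thesis unfolding A_rel
      using via_reflcl[of p "arrows G" i k] via_mono[of p "arrows G" i k "(arrows G)\<^sup>="] by blast
  qed
  also have "via p (arrows G) i k \<longleftrightarrow> via p r i k"
    using via_r_iff[OF parts(4) ik(1,2)] by blast
  finally show ?thesis .
qed

lemma S_nonzero_iff: "S i k \<noteq> 0 \<longleftrightarrow> (i = k \<and> i \<in> F) \<or> (i, k) \<in> s"
proof -
  define X where "X = mmul R (mtransp (sub A R R)) (sub A R R)"
  have "X i k \<noteq> 0 \<longleftrightarrow> (\<exists>j\<in>R. (j, i) \<in> (arrows G)\<^sup>= \<and> (j, k) \<in> (arrows G)\<^sup>=)" if "i \<in> F" "k \<in> F"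
  proof -
    have R: "i \<in> R" "k \<in> R" using that by (auto simp: R_def)
    have "X i k \<noteq> 0 \<longleftrightarrow> (\<exists>j\<in>R. mtransp (sub A R R) i j * sub A R R j k \<noteq> 0)"
      unfolding X_def mmul_def using finite_parts
      by (intro sum_nonneg_nonzero_iff) (auto simp: mtransp_def sub_def A_def edge_matrix_def)
    also have "\<dots> \<longleftrightarrow> (\<exists>j\<in>R. (j, i) \<in> (arrows G)\<^sup>= \<and> (j, k) \<in> (arrows G)\<^sup>=)"
      by (intro bex_cong refl) (use R in \<open>simp add: mtransp_def sub_def A_def edge_matrix_def; blast\<close>)
    finally show ?thesis .
  qed
  moreover have "S i k \<noteq> 0 \<longleftrightarrow> i \<in> F \<and> k \<in> F \<and> X i k \<noteq> 0"
    by (auto simp: S_def X_def[symmetric] sub_def[of _ F F] In_def)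
  moreover have "F \<subseteq> R" by (auto simp: R_def)
  ultimately show ?thesis by (auto simp: s_def)
qed

lemma Z_eq:
  assumes "i \<in> F" "k \<in> F"
  shows "Z i k = of_bool (i = k \<or> via q s i k)"
proof -
  have "Z i k = of_bool (via q {(i, k). S i k \<noteq> 0} i k)"
    unfolding Z_def
  proof (rule zer_eq_via)
    show "i \<in> q \<union> v" "k \<in> q \<union> v" using assms by (auto simp: q_def v_def)
    show "S i k \<in> {0, 1}" for i k by (simp add: S_def sub_def In_def)
    show "S i i \<noteq> 0" if "i \<in> q" for i using that parts S_nonzero_iff by auto
  qed (use finite_parts in \<open>auto simp: q_def v_def\<close>)
  also have "via q {(i, k). S i k \<noteq> 0} i k \<longleftrightarrow> i = k \<or> via q s i k"
  proof (cases "i = k")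
    case True
    then show ?thesis using assms S_nonzero_iff by (auto intro: via.edge)
  next
    case False
    have "s \<subseteq> {(i, k). S i k \<noteq> 0}" "{(i, k). S i k \<noteq> 0} \<subseteq> s\<^sup>="
      using S_nonzero_iff by auto
    then show ?thesis
      using False via_mono[of q s i k] via_mono[of q _ i k "s\<^sup>="] via_reflcl[of q s i k] by blast
  qed
  finally show ?thesis .
qed

text \<open>Sums of nonnegative terms become disjunctions of walks. \<open>mident\<close> affects
  only the diagonal, which the graph ignores.\<close>

lemma H_eq_graph_of_matrices:
  "graph_of_matrices u v (sub D u u)
     (In (madd (sub D u v) (mmul q (sub D u q) (sub Z q v))))
     (In (madd (madd (sub mident u u) (mmul p (sub D u p) (mtransp (sub D u p))))
               (mmul q (sub D u q) (mmul q (sub Z q q) (mtransp (sub D u q))))))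
     (sub Z v v) = H"
proof -
  have D01: "D i k \<in> {0, 1}" if "i \<in> u" "k \<in> u \<union> M \<union> F" for i k
    using D_eq[OF that] by simp
  have D_nonneg: "D i k \<ge> 0" if "i \<in> u" "k \<in> u \<union> M \<union> F" for i k
    using D_eq[OF that] by simp
  have Z_nonneg: "Z i k \<ge> 0" if "i \<in> F" "k \<in> F" for i k
    using Z_eq[OF that] by simp
  have in_F: "k \<in> F" if "k \<in> q \<union> v" for k using that parts by auto
  have D_iff: "D i k \<noteq> 0 \<longleftrightarrow> via p r i k" if "i \<in> u" "k \<in> p \<union> F" for i k
  proof -
    have "i \<noteq> k" "k \<in> u \<union> M \<union> F" using that parts sets by (auto simp: p_def)
    then show ?thesis using D_eq[of i k] that by simp
  qed
  have uv: "In (madd (sub D u v) (mmul q (sub D u q) (sub Z q v))) i k = 1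
      \<longleftrightarrow> via p r i k \<or> to_F i k" if ik: "i \<in> u" "k \<in> v" for i k
  proof -
    let ?m = "mmul q (sub D u q) (sub Z q v) i k"
    have "?m \<ge> 0" unfolding mmul_def
      using ik D_nonneg Z_nonneg in_F by (auto simp: sub_def intro!: sum_nonneg)
    have "?m \<noteq> 0 \<longleftrightarrow> (\<exists>j\<in>q. sub D u q i j * sub Z q v j k \<noteq> 0)"
      unfolding mmul_def using finite_parts ik D_nonneg Z_nonneg in_F
      by (intro sum_nonneg_nonzero_iff) (auto simp: sub_def)
    also have "\<dots> \<longleftrightarrow> (\<exists>j\<in>q. D i j \<noteq> 0 \<and> Z j k \<noteq> 0)"
      using ik by (auto simp: sub_def)
    also have "\<dots> \<longleftrightarrow> to_F i k"
    proof -
      have "D i j \<noteq> 0 \<and> Z j k \<noteq> 0 \<longleftrightarrow> via p r i j \<and> via q s j k" if "j \<in> q" for j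
      proof -
        \<comment> \<open>As \<open>q\<close> and \<open>v\<close> are disjoint, the diagonal of
          \<open>Z\<close> does not interfere here.\<close>
        have "j \<noteq> k" using that ik by (auto simp: q_def v_def)
        then show ?thesis using D_iff[of i j] Z_eq[of j k] in_F that ik by auto
      qed
      then show ?thesis using in_F ik by (auto simp: to_F_def)
    qed
    finally have "?m \<noteq> 0 \<longleftrightarrow> to_F i k" .
    moreover have "D i k \<noteq> 0 \<longleftrightarrow> via p r i k" "D i k \<ge> 0"
      using D_iff[of i k] D_nonneg[of i k] ik in_F by auto
    ultimately show ?thesis using \<open>?m \<ge> 0\<close> ik
      by (auto simp: In_def madd_def sub_def add_nonneg_eq_0_iff)
  qed
  have uu: "In (madd (madd (sub mident u u) (mmul p (sub D u p) (mtransp (sub D u p))))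
               (mmul q (sub D u q) (mmul q (sub Z q q) (mtransp (sub D u q))))) i k = 1
      \<longleftrightarrow> cov i k" if ik: "i \<in> u" "k \<in> u" "i \<noteq> k" for i k
  proof -
    let ?m = "mmul p (sub D u p) (mtransp (sub D u p)) i k"
    let ?W = "mmul q (sub Z q q) (mtransp (sub D u q))"
    let ?n = "mmul q (sub D u q) ?W i k"
    have DM: "D i j \<ge> 0" if "i \<in> u" "j \<in> p \<union> q" for i j
      using D_nonneg[OF that(1)] that(2) parts by auto
    have m0: "?m \<ge> 0" unfolding mmul_def
      using ik DM by (auto simp: sub_def mtransp_def intro!: sum_nonneg)
    have "?m \<noteq> 0 \<longleftrightarrow> (\<exists>j\<in>p. sub D u p i j * mtransp (sub D u p) j k \<noteq> 0)"
      unfolding mmul_def using finite_parts ik DM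
      by (intro sum_nonneg_nonzero_iff) (auto simp: sub_def mtransp_def)
    also have "\<dots> \<longleftrightarrow> (\<exists>j\<in>p. via p r i j \<and> via p r k j)"
      using ik D_iff by (auto simp: sub_def mtransp_def)
    finally have m: "?m \<noteq> 0 \<longleftrightarrow> (\<exists>j\<in>p. via p r i j \<and> via p r k j)" .
    have W0: "?W j k \<ge> 0" if "j \<in> q" for j
      unfolding mmul_def using ik that DM Z_nonneg in_F
      by (auto simp: sub_def mtransp_def intro!: sum_nonneg)
    \<comment> \<open>Here the unit diagonal of \<open>Z\<close> supplies the alternative
      \<open>j = j'\<close> of \<open>cov\<close>.\<close>
    have W: "?W j k \<noteq> 0 \<longleftrightarrow> (\<exists>j'\<in>q. (j = j' \<or> via q s j j') \<and> via p r k j')" if "j \<in> q" for j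
    proof -
      have "?W j k \<noteq> 0 \<longleftrightarrow> (\<exists>j'\<in>q. sub Z q q j j' * mtransp (sub D u q) j' k \<noteq> 0)"
        unfolding mmul_def using finite_parts ik DM Z_nonneg in_F that
        by (intro sum_nonneg_nonzero_iff) (auto simp: sub_def mtransp_def)
      also have "\<dots> \<longleftrightarrow> (\<exists>j'\<in>q. Z j j' \<noteq> 0 \<and> D k j' \<noteq> 0)"
        using ik that by (auto simp: sub_def mtransp_def)
      also have "\<dots> \<longleftrightarrow> (\<exists>j'\<in>q. (j = j' \<or> via q s j j') \<and> via p r k j')"
        by (intro bex_cong refl) (use ik that D_iff Z_eq in_F in auto)
      finally show ?thesis .
    qed
    have n0: "?n \<ge> 0" unfolding mmul_def[of q "sub D u q"]
      using ik DM W0 by (auto simp: sub_def intro!: sum_nonneg)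
    have "?n \<noteq> 0 \<longleftrightarrow> (\<exists>j\<in>q. sub D u q i j * ?W j k \<noteq> 0)"
      unfolding mmul_def[of q "sub D u q"] using finite_parts ik DM W0
      by (intro sum_nonneg_nonzero_iff) (auto simp: sub_def)
    also have "\<dots> \<longleftrightarrow> (\<exists>j\<in>q. via p r i j \<and> ?W j k \<noteq> 0)"
      by (intro bex_cong refl) (use ik D_iff in_F in \<open>auto simp: sub_def\<close>)
    also have "\<dots> \<longleftrightarrow> (\<exists>j\<in>q. \<exists>j'\<in>q. via p r i j \<and> (j = j' \<or> via q s j j') \<and> via p r k j')"
      using W by (simp only: bex_simps) blast
    finally show ?thesis
      using m m0 n0 ik by (auto simp: cov_def In_def madd_def sub_def mident_def add_nonneg_eq_0_iff)
  qed
  have vv: "sub Z v v i k = 1 \<longleftrightarrow> via q s i k" if "i \<in> v" "k \<in> v" "i \<noteq> k" for i k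
    using Z_eq[of i k] in_F that by (simp add: sub_def)
  \<comment> \<open>\<open>to_F\<close> is vacuous for \<open>k\<close> in \<open>u\<close>, which
    is disjoint from \<open>F\<close>.\<close>
  have Huu: "sub D u u i k = 1 \<longleftrightarrow> via p r i k \<or> to_F i k" if "i \<in> u" "k \<in> u" "i \<noteq> k" for i k
    using D_eq[of i k] that parts sets by (auto simp: sub_def to_F_def)
  have "i \<noteq> k" if "i \<in> u" "k \<in> v" for i k using that parts by blast
  then show ?thesis
    unfolding graph_of_matrices_def H_def
    by (simp add: uv uu vv Huu set_eq_iff cong: conj_cong) blast
qed

end

end

theorem corollary4:
  fixes d :: nat and G :: "nat mixed_graph"
    and V C M F R O' N u v p q :: "nat set"
    and A S D Z Sqq P Svv_qO Huu Huv Svv_uM Wuu :: "nat matrix"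
  assumes "parent_graph d G" and "V = nodes G" and "A = edge_matrix G"
    and "C \<subseteq> V" and "M \<subseteq> V - C"
    and "F = {k \<in> V - C. \<exists>i\<in>C. is_ancestor G k i}"
    and "R = C \<union> F" and "O' = V - R" and "N = V - (C \<union> M)"
    and "u = O' - M" and "v = F - M" and "p = O' - u" and "q = F - v"
    and "S = sub (In (mmul R (mtransp (sub A R R)) (sub A R R))) F F"
    and "D = zer p (V - p) A"
    and "Z = zer q v S"
    and "Sqq = sub Z q q" and "P = sub Z q v" and "Svv_qO = sub Z v v"
    and "Huu = sub D u u"
    and "Huv = In (madd (sub D u v) (mmul q (sub D u q) P))"
    and "Svv_uM = Svv_qO"
    and "Wuu = In (madd (madd (sub mident u u) (mmul p (sub D u p) (mtransp (sub D u p))))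
                        (mmul q (sub D u q) (mmul q Sqq (mtransp (sub D u q)))))"
  shows "summary_graph u v (graph_of_matrices u v Huu Huv Wuu Svv_uM) \<and>
    nodes (graph_of_matrices u v Huu Huv Wuu Svv_uM) = N \<and>
    (\<forall>\<alpha> \<beta> c. \<alpha> \<subseteq> N \<and> \<beta> \<subseteq> N \<and> c \<subseteq> N \<and>
        \<alpha> \<inter> \<beta> = {} \<and> \<alpha> \<inter> c = {} \<and> \<beta> \<inter> c = {} \<and> \<alpha> \<noteq> {} \<and> \<beta> \<noteq> {} \<longrightarrow>
        (implies_indep (graph_of_matrices u v Huu Huv Wuu Svv_uM) \<alpha> \<beta> c \<longleftrightarrow>
         implies_indep G \<alpha> \<beta> (c \<union> C)))"
proof -
  have G: "V = {1..d}" "arrows G \<subseteq> V \<times> V" "arrows G \<subseteq> {(i, k). i < k}"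
    "dashed G = {}" "full G = {}"
    using assms(1,2) by (auto simp: parent_graph_def)
  have acyclic: "acyclic (arrows G)"
  proof (rule acyclicI, intro allI notI)
    fix i assume "(i, i) \<in> (arrows G)\<^sup>+"
    moreover have "i < k" if "(i, k) \<in> (arrows G)\<^sup>+" for i k
      using that by induction (use G in fastforce)+
    ultimately show False by blast
  qed
  interpret L: summarised_dag G V C M
    by unfold_locales (rule G(2) acyclic G(4) G(5) assms(4) assms(5))+
  \<comment> \<open>The complements \<open>O' - u\<close> and \<open>F - v\<close> are the
    intersections with \<open>M\<close> that define \<open>L.p\<close> and
    \<open>L.q\<close>.\<close>
  have eqs: "F = L.F" "R = L.R" "O' = L.Oc" "u = L.u" "v = L.v" "p = L.p" "q = L.q"
    unfolding assms(6-8,10-13) L.F_def L.R_def L.Oc_def L.u_def L.v_def L.p_def L.q_def by blast+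
  have matrices: "A = L.A" "S = L.S" "D = L.D" "Z = L.Z"
    unfolding assms(3,14-16) L.A_def L.S_def L.D_def L.Z_def eqs by (rule refl)+
  have "finite V" using G by simp
  then have H: "graph_of_matrices u v Huu Huv Wuu Svv_uM = L.H"
    unfolding assms(17-23) eqs matrices by (rule L.H_eq_graph_of_matrices)
  have N: "N = L.u \<union> L.v" using L.parts assms(9) by auto
  \<comment> \<open>A directed acyclic graph is a summary graph with empty \<open>v\<close>, so the
    reachability criterion applies to \<open>G\<close> too.\<close>
  have "summary_graph V {} G"
    using G acyclic assms(2) acyclic_subset[of "arrows G"]
    by (auto simp: summary_graph_def irrefl_def sym_def)
  then show ?thesis
    unfolding H
    unfolding N eqs
    using L.summary_graph_H[OF \<open>finite V\<close>] L.implies_indep_H_iff[OF \<open>finite V\<close>]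
    by (auto simp: L.H_def)
qed

end
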